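(* Let $G$ be a connected cubic graph with $\nu$ vertices which is a line graph, i.e. $G=L(H)$ for some connected graph $H$ (possibly with multiple edges, no loops). Then: (1) if $G=K_4$, then $M(G)=3$; (2) if $G\neq K_4$, then there exists a connected cubic graph $G^+$ with $\nu/3$ vertices such that $G=L(S(G^+))$; moreover $M(G)=2^{\nu/6+1}$, and (for $\nu\to\infty$) the entropy $\lim \frac{2\log M(G)}{\nu}$ of $G$ equals $\frac{\log 2}{3}$.
   Context: $M(X)$ denotes the number of perfect matchings of a graph $X$ (parallel edges are distinct edges). For a graph $H$ (possibly with multiple edges, no loops), the line graph $L(H)$ has vertex set $E(H)$, and two distinct vertices $e,f$ are joined by exactly $i$ edges ($i=0,1,2$) iff the edges $e,f$ of $H$ share exactly $i$ end vertices. $S(X)$ denotes the graph obtained from $X$ by subdividing every edge exactly once. $K_4$ is the complete graph on four vertices. The entropy of a graph with $N$ vertices, $N\to\infty$, is $\lim_{N\to\infty}\frac{2\log M}{N}$ where $M$ is its number of perfect matchings. *)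

theory Defs
  imports Complex_Main "HOL-Library.Multiset"
begin

text \<open>Undirected multigraphs. The ends of an edge form a multiset of size two, so parallel
  edges are distinct edges with equal ends and a loop at \<open>v\<close> has ends \<open>{#v, v#}\<close>.\<close>

record ('v, 'e) mgraph =
  verts :: "'v set"
  edges :: "'e set"
  ends :: "'e \<Rightarrow> 'v multiset"

definition finite_mgraph :: "('v, 'e) mgraph \<Rightarrow> bool" where
  "finite_mgraph X \<longleftrightarrow> finite (verts X) \<and> finite (edges X) \<and>
     (\<forall>e\<in>edges X. size (ends X e) = 2 \<and> set_mset (ends X e) \<subseteq> verts X)"

definition loopless :: "('v, 'e) mgraph \<Rightarrow> bool" where
  "loopless X \<longleftrightarrow> (\<forall>e\<in>edges X. \<forall>v. ends X e \<noteq> {#v, v#})"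

definition adjacent :: "('v, 'e) mgraph \<Rightarrow> 'v \<Rightarrow> 'v \<Rightarrow> bool" where
  "adjacent X u v \<longleftrightarrow> (\<exists>e\<in>edges X. ends X e = {#u, v#})"

definition connected_mgraph :: "('v, 'e) mgraph \<Rightarrow> bool" where
  "connected_mgraph X \<longleftrightarrow>
     verts X \<noteq> {} \<and> (\<forall>u\<in>verts X. \<forall>v\<in>verts X. (adjacent X)\<^sup>*\<^sup>* u v)"

text \<open>A loop contributes two to the degree of its vertex.\<close>

definition degree :: "('v, 'e) mgraph \<Rightarrow> 'v \<Rightarrow> nat" where
  "degree X v = (\<Sum>e\<in>edges X. count (ends X e) v)"

definition cubic :: "('v, 'e) mgraph \<Rightarrow> bool" where
  "cubic X \<longleftrightarrow> (\<forall>v\<in>verts X. degree X v = 3)"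

definition connected_cubic :: "('v, 'e) mgraph \<Rightarrow> bool" where
  "connected_cubic X \<longleftrightarrow> finite_mgraph X \<and> connected_mgraph X \<and> cubic X"

definition mgraph_iso :: "('v, 'e) mgraph \<Rightarrow> ('w, 'f) mgraph \<Rightarrow> bool" (infix "\<simeq>" 50) where
  "X \<simeq> Y \<longleftrightarrow> (\<exists>f g. bij_betw f (verts X) (verts Y) \<and> bij_betw g (edges X) (edges Y) \<and>
     (\<forall>e\<in>edges X. ends Y (g e) = image_mset f (ends X e)))"

definition perfect_matching :: "('v, 'e) mgraph \<Rightarrow> 'e set \<Rightarrow> bool" where
  "perfect_matching X F \<longleftrightarrow> F \<subseteq> edges X \<and> (\<forall>e\<in>F. \<forall>v. ends X e \<noteq> {#v, v#}) \<and>
     (\<forall>v\<in>verts X. \<exists>!e. e \<in> F \<and> v \<in># ends X e)"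

definition num_perfect_matchings :: "('v, 'e) mgraph \<Rightarrow> nat" where
  "num_perfect_matchings X = card {F. perfect_matching X F}"

text \<open>The line graph of a loopless multigraph: one edge \<open>({e, f}, v)\<close> for every common end
  vertex \<open>v\<close> of two distinct edges \<open>e\<close> and \<open>f\<close>, see \<open>line_graph_multiplicity\<close> below.\<close>

definition line_graph :: "('v, 'e) mgraph \<Rightarrow> ('e, 'e set \<times> 'v) mgraph" where
  "line_graph X = \<lparr>verts = edges X,
     edges = {({e, f}, v) | e f v. e \<in> edges X \<and> f \<in> edges X \<and> e \<noteq> f \<and>
                v \<in># ends X e \<and> v \<in># ends X f},
     ends = (\<lambda>(A, v). mset_set A)\<rparr>"

lemma line_graph_multiplicity:
  assumes "e \<in> edges X" "f \<in> edges X" "e \<noteq> f"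
  shows "card {d \<in> edges (line_graph X). ends (line_graph X) d = {#e, f#}} =
         card (set_mset (ends X e) \<inter> set_mset (ends X f))"
proof -
  have *: "A = {e, f}" if "mset_set A = {#e, f#}" for A
    using that by (metis finite_set_mset_mset_set infinite_set_mset_mset_set set_mset_add_mset_insert
        set_mset_empty insert_not_empty)
  have **: "mset_set {e, f} = {#e, f#}"
    using assms(3) by simp
  have "{d \<in> edges (line_graph X). ends (line_graph X) d = {#e, f#}} =
        Pair {e, f} ` (set_mset (ends X e) \<inter> set_mset (ends X f))" (is "?L = ?R")
  proof
    show "?L \<subseteq> ?R"
      by (auto simp: line_graph_def doubleton_eq_iff dest!: *)
    show "?R \<subseteq> ?L"
      using assms ** by (auto simp: line_graph_def)
  qed
  then show ?thesis
    by (simp add: card_image inj_on_def)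
qed

text \<open>\<open>L(H)\<close> is formed for connected loopless \<open>H\<close>, and graphs are identified up to
  isomorphism.\<close>

definition is_line_graph_of :: "('v, 'e) mgraph \<Rightarrow> ('w, 'f) mgraph \<Rightarrow> bool" where
  "is_line_graph_of G H \<longleftrightarrow>
     finite_mgraph H \<and> loopless H \<and> connected_mgraph H \<and> G \<simeq> line_graph H"

text \<open>\<open>Inr e\<close> is the vertex subdividing \<open>e\<close>. The half-edge \<open>(e, v, k)\<close> joins the end \<open>v\<close> of \<open>e\<close>
  to it; \<open>k\<close> is always \<open>0\<close> unless \<open>e\<close> is a loop, which has the two halves \<open>(e, v, 0)\<close> and
  \<open>(e, v, 1)\<close>, so that subdividing a loop yields two parallel edges.\<close>

definition subdivision :: "('v, 'e) mgraph \<Rightarrow> ('v + 'e, 'e \<times> 'v \<times> nat) mgraph" where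
  "subdivision X = \<lparr>verts = Inl ` verts X \<union> Inr ` edges X,
     edges = {(e, v, k). e \<in> edges X \<and> k < count (ends X e) v},
     ends = (\<lambda>(e, v, k). {#Inl v, Inr e#})\<rparr>"

definition complete_graph :: "nat \<Rightarrow> (nat, nat set) mgraph" where
  "complete_graph n = \<lparr>verts = {..<n}, edges = {A. A \<subseteq> {..<n} \<and> card A = 2}, ends = mset_set\<rparr>"

end

(* A vertex of L(H) belonging to an edge uv of H has degree d(u) + d(v) - 2, so for cubic L(H) the
   degrees along every edge of H add up to five. Either some vertex has degree four, and then H is
   the star with four edges and L(H) = K_4, or every edge joins a vertex of degree two to one of
   degree three, and then H is the subdivision of the graph G^+ on the vertices of degree three.

   A perfect matching of L(H) pairs each edge e of H with another edge at one of the two ends of e.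
   When all degrees of H are at most three, it is therefore the same as a choice of one end for each
   edge such that every vertex is chosen an even number of times. Changing the choice at the edge uv
   changes the parities exactly at u and v. As H is connected, each of the 2^(n-1) even subsets of
   the n vertices is thus the set of odd vertices of equally many of the 2^m choices, which leaves
   2^(m-n+1) perfect matchings; here m = nu and n = 5 nu / 6. *)

theory Submission
  imports Defs "HOL-Library.FuncSet"
begin

subsection \<open>Multigraphs and isomorphisms\<close>

lemma finite_mgraphD:
  assumes "finite_mgraph X"
  shows "finite (verts X)" "finite (edges X)"
    "e \<in> edges X \<Longrightarrow> size (ends X e) = 2"
    "e \<in> edges X \<Longrightarrow> v \<in># ends X e \<Longrightarrow> v \<in> verts X"
  using assms by (auto simp: finite_mgraph_def)

lemma size_eq_two_iff: "size M = 2 \<longleftrightarrow> (\<exists>u v. M = {#u, v#})"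
proof
  assume "size M = 2"
  then obtain u N where "M = add_mset u N" "size N = 1"
    by (metis Suc_1 size_eq_Suc_imp_eq_union size_add_mset Suc_inject One_nat_def)
  then show "\<exists>u v. M = {#u, v#}"
    by (metis size_1_singleton_mset)
qed auto

lemma loopless_endsE:
  assumes "finite_mgraph X" "loopless X" "e \<in> edges X"
  obtains u v where "ends X e = {#u, v#}" "u \<noteq> v" "u \<in> verts X" "v \<in> verts X"
proof -
  obtain u v where uv: "ends X e = {#u, v#}"
    using finite_mgraphD(3)[OF assms(1,3)] by (auto simp: size_eq_two_iff)
  moreover have "u \<noteq> v"
    using uv assms(2,3) by (auto simp: loopless_def)
  ultimately show thesis
    using finite_mgraphD(4)[OF assms(1,3)] that by simp
qed

lemma adjacent_sym: "adjacent X u v \<Longrightarrow> adjacent X v u"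
  by (auto simp: adjacent_def add_mset_commute)

text \<open>In a loopless graph the cardinality of this set is the degree, so degrees of H are
  counted here without multiplicities.\<close>

definition incident :: "('v, 'e) mgraph \<Rightarrow> 'v \<Rightarrow> 'e set" where
  "incident X v = {e \<in> edges X. v \<in># ends X e}"

lemma finite_incident: "finite_mgraph X \<Longrightarrow> finite (incident X v)"
  by (simp add: incident_def finite_mgraphD)

section \<open>Composition and inversion of isomorphisms\<close>

lemma mgraph_isoE:
  assumes "X \<simeq> Y"
  obtains f g where "bij_betw f (verts X) (verts Y)" "bij_betw g (edges X) (edges Y)"
    "\<And>e. e \<in> edges X \<Longrightarrow> ends Y (g e) = image_mset f (ends X e)"
  using assms by (auto simp: mgraph_iso_def)

lemma mgraph_isoI:
  assumes "bij_betw f (verts X) (verts Y)" "bij_betw g (edges X) (edges Y)"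
    "\<And>e. e \<in> edges X \<Longrightarrow> ends Y (g e) = image_mset f (ends X e)"
  shows "X \<simeq> Y"
  using assms by (auto simp: mgraph_iso_def)

lemma mem_ends_iso:
  assumes "finite_mgraph X" "bij_betw f (verts X) (verts Y)" "e \<in> edges X" "v \<in> verts X"
  shows "f v \<in># image_mset f (ends X e) \<longleftrightarrow> v \<in># ends X e"
proof -
  have "set_mset (ends X e) \<subseteq> verts X"
    using finite_mgraphD(4)[OF assms(1,3)] by blast
  then show ?thesis
    using assms(2,4) inj_on_image_mem_iff[of f "verts X" v "set_mset (ends X e)"]
    by (simp add: bij_betw_def)
qed

lemma mgraph_iso_trans:
  assumes "X \<simeq> Y" "Y \<simeq> Z"
  shows "X \<simeq> Z"
proof -
  obtain f g where fg: "bij_betw f (verts X) (verts Y)" "bij_betw g (edges X) (edges Y)"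
    "\<And>e. e \<in> edges X \<Longrightarrow> ends Y (g e) = image_mset f (ends X e)"
    using mgraph_isoE[OF assms(1)] by blast
  obtain f' g' where fg': "bij_betw f' (verts Y) (verts Z)" "bij_betw g' (edges Y) (edges Z)"
    "\<And>e. e \<in> edges Y \<Longrightarrow> ends Z (g' e) = image_mset f' (ends Y e)"
    using mgraph_isoE[OF assms(2)] by blast
  show ?thesis
  proof (rule mgraph_isoI)
    show "bij_betw (f' \<circ> f) (verts X) (verts Z)" "bij_betw (g' \<circ> g) (edges X) (edges Z)"
      using fg fg' by (auto intro: bij_betw_trans)
    show "ends Z ((g' \<circ> g) e) = image_mset (f' \<circ> f) (ends X e)" if "e \<in> edges X" for e
      using that fg(3) fg'(3) bij_betwE[OF fg(2)] by (simp add: multiset.map_comp)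
  qed
qed

lemma mgraph_iso_sym:
  assumes "finite_mgraph X" "X \<simeq> Y"
  shows "Y \<simeq> X"
proof -
  obtain f g where fg: "bij_betw f (verts X) (verts Y)" "bij_betw g (edges X) (edges Y)"
    "\<And>e. e \<in> edges X \<Longrightarrow> ends Y (g e) = image_mset f (ends X e)"
    using mgraph_isoE[OF assms(2)] by blast
  show ?thesis
  proof (rule mgraph_isoI)
    show "bij_betw (inv_into (verts X) f) (verts Y) (verts X)"
      "bij_betw (inv_into (edges X) g) (edges Y) (edges X)"
      using fg by (auto intro: bij_betw_inv_into)
    fix e assume "e \<in> edges Y"
    then obtain d where d: "d \<in> edges X" "e = g d"
      using fg(2) by (auto simp: bij_betw_def)
    have "inv_into (verts X) f (f v) = v" if "v \<in># ends X d" for v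
      using fg(1) finite_mgraphD(4)[OF assms(1) d(1) that] by (simp add: bij_betw_def)
    then have "image_mset (inv_into (verts X) f) (ends Y e) = ends X d"
      using d fg(3) multiset.map_cong0[of "ends X d" "inv_into (verts X) f \<circ> f" id]
      by (simp add: multiset.map_comp)
    then show "ends X (inv_into (edges X) g e) = image_mset (inv_into (verts X) f) (ends Y e)"
      using d fg(2) by (simp add: bij_betw_def)
  qed
qed

section \<open>Properties preserved by isomorphisms\<close>

lemma finite_mgraph_iso:
  assumes "finite_mgraph X" "X \<simeq> Y"
  shows "finite_mgraph Y"
proof -
  obtain f g where fg: "bij_betw f (verts X) (verts Y)" "bij_betw g (edges X) (edges Y)"
    "\<And>e. e \<in> edges X \<Longrightarrow> ends Y (g e) = image_mset f (ends X e)"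
    using mgraph_isoE[OF assms(2)] by blast
  have "verts Y = f ` verts X" "edges Y = g ` edges X"
    using fg by (auto simp: bij_betw_def)
  then show ?thesis
    using assms(1) fg(3) by (simp add: finite_mgraph_def image_mono)
qed

lemma count_image_mset_inj_on:
  assumes "inj_on f (insert v (set_mset M))"
  shows "count (image_mset f M) (f v) = count M v"
  using assms by (induction M) (auto simp: inj_on_def)

lemma cubic_iso:
  assumes "finite_mgraph X" "X \<simeq> Y" "cubic X"
  shows "cubic Y"
proof -
  obtain f g where fg: "bij_betw f (verts X) (verts Y)" "bij_betw g (edges X) (edges Y)"
    "\<And>e. e \<in> edges X \<Longrightarrow> ends Y (g e) = image_mset f (ends X e)"
    using mgraph_isoE[OF assms(2)] by blast
  have "degree Y (f v) = degree X v" if v: "v \<in> verts X" for v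
  proof -
    have "degree Y (f v) = (\<Sum>e\<in>edges X. count (ends Y (g e)) (f v))"
      unfolding degree_def using fg(2) by (rule sum.reindex_bij_betw[symmetric])
    also have "\<dots> = (\<Sum>e\<in>edges X. count (ends X e) v)"
    proof (rule sum.cong[OF refl])
      fix e assume e: "e \<in> edges X"
      have "inj_on f (insert v (set_mset (ends X e)))"
        using fg(1) v finite_mgraphD(4)[OF assms(1) e]
        by (auto simp: bij_betw_def inj_on_def)
      then have "count (image_mset f (ends X e)) (f v) = count (ends X e) v"
        by (rule count_image_mset_inj_on)
      then show "count (ends Y (g e)) (f v) = count (ends X e) v"
        using fg(3)[OF e] by simp
    qed
    finally show ?thesis by (simp add: degree_def)
  qed
  moreover have "verts Y = f ` verts X"
    using fg(1) by (simp add: bij_betw_def)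
  ultimately show ?thesis
    using assms(3) by (auto simp: cubic_def)
qed

lemma loopless_iso:
  assumes "finite_mgraph X" "X \<simeq> Y" "loopless X"
  shows "loopless Y"
proof -
  obtain f g where fg: "bij_betw f (verts X) (verts Y)" "bij_betw g (edges X) (edges Y)"
    "\<And>e. e \<in> edges X \<Longrightarrow> ends Y (g e) = image_mset f (ends X e)"
    using mgraph_isoE[OF assms(2)] by blast
  have "ends Y (g e) \<noteq> {#x, x#}" if e: "e \<in> edges X" for e x
  proof -
    obtain u v where "ends X e = {#u, v#}" "u \<noteq> v" "u \<in> verts X" "v \<in> verts X"
      using assms(1,3) e by (rule loopless_endsE)
    then show ?thesis
      using fg(1) fg(3)[OF e] by (auto simp: bij_betw_def add_eq_conv_diff dest: inj_onD)
  qed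
  moreover have "edges Y = g ` edges X"
    using fg(2) by (simp add: bij_betw_def)
  ultimately show ?thesis
    by (auto simp: loopless_def)
qed

lemma connected_mgraph_iso:
  assumes "X \<simeq> Y" "connected_mgraph X"
  shows "connected_mgraph Y"
proof -
  obtain f g where fg: "bij_betw f (verts X) (verts Y)" "bij_betw g (edges X) (edges Y)"
    "\<And>e. e \<in> edges X \<Longrightarrow> ends Y (g e) = image_mset f (ends X e)"
    using mgraph_isoE[OF assms(1)] by blast
  have adj: "adjacent Y (f u) (f v)" if uv: "adjacent X u v" for u v
  proof -
    obtain e where "e \<in> edges X" "ends X e = {#u, v#}"
      using uv by (auto simp: adjacent_def)
    then have "g e \<in> edges Y" "ends Y (g e) = {#f u, f v#}"
      using fg(3) bij_betwE[OF fg(2)] by simp_all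
    then show ?thesis
      by (auto simp: adjacent_def)
  qed
  have "(adjacent Y)\<^sup>*\<^sup>* (f u) (f v)" if "(adjacent X)\<^sup>*\<^sup>* u v" for u v
    using that by (induction rule: rtranclp_induct) (auto intro: rtranclp.rtrancl_into_rtrancl adj)
  moreover have "verts Y = f ` verts X"
    using fg(1) by (simp add: bij_betw_def)
  ultimately show ?thesis
    using assms(2) by (simp add: connected_mgraph_def)
qed

section \<open>Isomorphism invariance of the number of perfect matchings\<close>

lemma perfect_matching_iso_image:
  assumes "finite_mgraph X" "bij_betw f (verts X) (verts Y)" "bij_betw g (edges X) (edges Y)"
    "\<And>e. e \<in> edges X \<Longrightarrow> ends Y (g e) = image_mset f (ends X e)"
    and F: "perfect_matching X F"
  shows "perfect_matching Y (g ` F)"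
proof -
  have FE: "e \<in> edges X" if "e \<in> F" for e
    using F that by (auto simp: perfect_matching_def)
  have mem: "f v \<in># ends Y (g e) \<longleftrightarrow> v \<in># ends X e" if "e \<in> F" "v \<in> verts X" for e v
    using mem_ends_iso[OF assms(1-2) FE[OF that(1)] that(2)] assms(4)[OF FE[OF that(1)]] by simp
  show ?thesis
    unfolding perfect_matching_def
  proof (intro conjI ballI allI)
    show "g ` F \<subseteq> edges Y"
      using FE bij_betwE[OF assms(3)] by blast
    show "ends Y e \<noteq> {#v, v#}" if e: "e \<in> g ` F" for e v
    proof
      assume loop: "ends Y e = {#v, v#}"
      obtain d where d: "d \<in> F" "e = g d"
        using e by blast
      obtain x y where xy: "ends X d = {#x, y#}"
        using finite_mgraphD(3)[OF assms(1) FE[OF d(1)]] by (auto simp: size_eq_two_iff)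
      then have "f x = f y"
        using loop d(2) assms(4)[OF FE[OF d(1)]] by (auto simp: add_eq_conv_diff)
      then have "x = y"
        using assms(2) xy finite_mgraphD(4)[OF assms(1) FE[OF d(1)], of x]
          finite_mgraphD(4)[OF assms(1) FE[OF d(1)], of y]
        by (simp add: bij_betw_def inj_on_def)
      then show False
        using F d xy by (auto simp: perfect_matching_def)
    qed
    fix w assume "w \<in> verts Y"
    then obtain v where v: "v \<in> verts X" "w = f v"
      using assms(2) by (auto simp: bij_betw_def)
    then have "\<exists>!e. e \<in> F \<and> v \<in># ends X e"
      using F by (auto simp: perfect_matching_def)
    then obtain e where e: "e \<in> F" "v \<in># ends X e"
      "\<And>d. d \<in> F \<Longrightarrow> v \<in># ends X d \<Longrightarrow> d = e"
      by blast
    show "\<exists>!e. e \<in> g ` F \<and> w \<in># ends Y e"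
    proof (rule ex1I[of _ "g e"])
      show "g e \<in> g ` F \<and> w \<in># ends Y (g e)"
        using e(1,2) v mem[OF e(1) v(1)] by simp
      show "d = g e" if "d \<in> g ` F \<and> w \<in># ends Y d" for d
        using that e(3) v mem[OF _ v(1)] by blast
    qed
  qed
qed

text \<open>The image map on edge sets is injective and preserves matchings. Equality follows by
  applying the inequality to the inverse isomorphism as well, which replaces a proof of
  surjectivity.\<close>

lemma num_perfect_matchings_iso_le:
  assumes "finite_mgraph X" "X \<simeq> Y"
  shows "num_perfect_matchings X \<le> num_perfect_matchings Y"
proof -
  obtain f g where fg: "bij_betw f (verts X) (verts Y)" "bij_betw g (edges X) (edges Y)"
    "\<And>e. e \<in> edges X \<Longrightarrow> ends Y (g e) = image_mset f (ends X e)"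
    using mgraph_isoE[OF assms(2)] by blast
  show ?thesis
    unfolding num_perfect_matchings_def
  proof (rule card_inj_on_le)
    have "inj_on (image g) (Pow (edges X))"
      using fg(2) by (simp add: bij_betw_def inj_on_image_Pow)
    then show "inj_on (image g) {F. perfect_matching X F}"
      by (rule inj_on_subset) (auto simp: perfect_matching_def)
    show "image g ` {F. perfect_matching X F} \<subseteq> {F. perfect_matching Y F}"
      using perfect_matching_iso_image[OF assms(1) fg] by blast
    have "{F. perfect_matching Y F} \<subseteq> Pow (edges Y)"
      by (auto simp: perfect_matching_def)
    then show "finite {F. perfect_matching Y F}"
      using finite_mgraphD(2)[OF finite_mgraph_iso[OF assms]] by (meson finite_Pow_iff finite_subset)
  qed
qed

lemma num_perfect_matchings_iso:
  assumes "finite_mgraph X" "X \<simeq> Y"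
  shows "num_perfect_matchings X = num_perfect_matchings Y"
  using num_perfect_matchings_iso_le[OF assms]
    num_perfect_matchings_iso_le[OF finite_mgraph_iso[OF assms] mgraph_iso_sym[OF assms]]
  by simp

subsection \<open>Parities of orientations\<close>

text \<open>For a fixed element \<open>a\<close> of \<open>V\<close>, each subset of
  \<open>V - {a}\<close> arises from exactly one even subset of \<open>V\<close>: \<open>a\<close>
  is added precisely when the size is odd.\<close>

lemma card_even_subsets:
  assumes "finite V" "V \<noteq> {}"
  shows "card {T. T \<subseteq> V \<and> even (card T)} = 2 ^ (card V - 1)"
proof -
  obtain a where a: "a \<in> V"
    using assms(2) by blast
  have "bij_betw (\<lambda>S. if even (card S) then S else insert a S) (Pow (V - {a}))
      {T. T \<subseteq> V \<and> even (card T)}"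
  proof (rule bij_betw_byWitness[where f' = "\<lambda>T. T - {a}"])
    show "\<forall>S\<in>Pow (V - {a}). (if even (card S) then S else insert a S) - {a} = S"
      by auto
    show "\<forall>T\<in>{T. T \<subseteq> V \<and> even (card T)}.
        (if even (card (T - {a})) then T - {a} else insert a (T - {a})) = T"
    proof
      fix T assume T: "T \<in> {T. T \<subseteq> V \<and> even (card T)}"
      then have "finite T"
        using assms(1) finite_subset by blast
      with T show "(if even (card (T - {a})) then T - {a} else insert a (T - {a})) = T"
        by (cases "a \<in> T") (auto simp: card_gt_0_iff Suc_diff_1 dest: card_Suc_Diff1 card.remove)
    qed
    show "(\<lambda>S. if even (card S) then S else insert a S) ` Pow (V - {a})
        \<subseteq> {T. T \<subseteq> V \<and> even (card T)}"
    proof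
      fix T assume "T \<in> (\<lambda>S. if even (card S) then S else insert a S) ` Pow (V - {a})"
      then obtain S where S: "S \<subseteq> V - {a}" "T = (if even (card S) then S else insert a S)"
        by blast
      then have "finite S" "a \<notin> S"
        using assms(1) finite_subset by auto
      then show "T \<in> {T. T \<subseteq> V \<and> even (card T)}"
        using a S by auto
    qed
   show "(\<lambda>T. T - {a}) ` {T. T \<subseteq> V \<and> even (card T)} \<subseteq> Pow (V - {a})"
      by auto
  qed
  then have "card {T. T \<subseteq> V \<and> even (card T)} = card (Pow (V - {a}))"
    by (rule bij_betw_same_card[symmetric])
  then show ?thesis
    using a assms(1) by (simp add: card_Pow)
qed

text \<open>Each edge points to its chosen end, and \<open>T\<close> is the set of vertices of odd
  indegree. The extensional product fixes the values off the edge set, so that distinct elements are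
  distinct choices.\<close>

definition orientations :: "('v, 'e) mgraph \<Rightarrow> 'v set \<Rightarrow> ('e \<Rightarrow> 'v) set" where
  "orientations X T = {\<phi> \<in> Pi\<^sub>E (edges X) (\<lambda>e. set_mset (ends X e)).
     \<forall>v\<in>verts X. odd (card {e \<in> edges X. \<phi> e = v}) \<longleftrightarrow> v \<in> T}"

lemma finite_orientations: "finite_mgraph X \<Longrightarrow> finite (orientations X T)"
  by (rule finite_subset[of _ "Pi\<^sub>E (edges X) (\<lambda>e. set_mset (ends X e))"])
    (auto simp: orientations_def finite_mgraphD intro!: finite_PiE)

text \<open>Addition of \<open>v\<close> modulo two: toggles commute, and two toggles at the same
  vertex cancel.\<close>

abbreviation toggle :: "'v \<Rightarrow> 'v set \<Rightarrow> 'v set" where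
  "toggle v T \<equiv> sym_diff T {v}"

lemma odd_card_toggle:
  assumes "finite A"
  shows "odd (card (toggle e A)) \<longleftrightarrow> even (card A)"
  using assms by (cases "e \<in> A") (auto simp: card_gt_0_iff Un_commute dest: card.remove)

text \<open>Reversing one edge between \<open>u\<close> and \<open>v\<close> changes the parity of
  the indegree at these two vertices and nowhere else. Reversal is an involution, hence
  injective.\<close>

lemma card_orientations_le_adjacent:
  assumes X: "finite_mgraph X" "loopless X" and "adjacent X u v"
  shows "card (orientations X T) \<le> card (orientations X (toggle v (toggle u T)))"
proof -
  obtain e where e: "e \<in> edges X" "ends X e = {#u, v#}"
    using assms(3) by (auto simp: adjacent_def)
  have uv: "u \<noteq> v"
    using X(2) e by (auto simp: loopless_def)
  define flip where "flip \<phi> = \<phi>(e := if \<phi> e = u then v else u)" for \<phi> :: "'b \<Rightarrow> 'a"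
  have at_e: "\<phi> e = u \<or> \<phi> e = v" if "\<phi> \<in> orientations X T" for \<phi>
    using that e by (auto simp: orientations_def PiE_iff)
  show ?thesis
  proof (rule card_inj_on_le[of flip])
    have "flip (flip \<phi>) = \<phi>" if "\<phi> \<in> orientations X T" for \<phi>
      using at_e[OF that] uv by (auto simp: flip_def)
    then show "inj_on flip (orientations X T)"
      by (metis inj_onI)
    show "flip ` orientations X T \<subseteq> orientations X (toggle v (toggle u T))"
    proof
      fix \<psi> assume "\<psi> \<in> flip ` orientations X T"
      then obtain \<phi> where \<phi>: "\<phi> \<in> orientations X T" and \<psi>: "\<psi> = flip \<phi>"
        by blast
      have "\<psi> \<in> Pi\<^sub>E (edges X) (\<lambda>e. set_mset (ends X e))"
        using \<phi> e by (auto simp: orientations_def \<psi> flip_def PiE_iff extensional_def)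
      moreover have "odd (card {d \<in> edges X. \<psi> d = x}) \<longleftrightarrow> x \<in> toggle v (toggle u T)"
        if x: "x \<in> verts X" for x
      proof (cases "x \<in> {u, v}")
        case True
        \<comment> \<open>At an end of \<open>e\<close> the fibre gains or loses \<open>e\<close>
          and nothing else.\<close>
        have "{d \<in> edges X. \<psi> d = x} = toggle e {d \<in> edges X. \<phi> d = x}"
          using True at_e[OF \<phi>] uv e(1) by (auto simp: \<psi> flip_def split: if_splits)
        moreover have "finite {d \<in> edges X. \<phi> d = x}"
          using finite_mgraphD(2)[OF X(1)] by simp
        ultimately show ?thesis
          using True uv x \<phi> by (auto simp: odd_card_toggle orientations_def)
      next
        case False
        then have "{d \<in> edges X. \<psi> d = x} = {d \<in> edges X. \<phi> d = x}"
          using at_e[OF \<phi>] by (auto simp: \<psi> flip_def split: if_splits)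
        then show ?thesis
          using False x \<phi> by (simp add: orientations_def)
      qed
      ultimately show "\<psi> \<in> orientations X (toggle v (toggle u T))"
        by (simp add: orientations_def)
    qed
    show "finite (orientations X (toggle v (toggle u T)))"
      using X(1) by (rule finite_orientations)
  qed
qed

lemma toggle_toggle [simp]: "toggle v (toggle v T) = T"
  by blast

text \<open>Toggling both ends twice restores \<open>T\<close>, so the previous inequality also
  holds in the other direction.\<close>

lemma card_orientations_adjacent:
  assumes "finite_mgraph X" "loopless X" "adjacent X u v"
  shows "card (orientations X (toggle v (toggle u T))) = card (orientations X T)"
proof (rule antisym)
  have "toggle v (toggle u (toggle v (toggle u T))) = T"
    by blast
  then show "card (orientations X (toggle v (toggle u T))) \<le> card (orientations X T)"
    using card_orientations_le_adjacent[OF assms, of "toggle v (toggle u T)"] by simp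
qed (rule card_orientations_le_adjacent[OF assms])

text \<open>Reversing the edges of a walk one after another toggles every intermediate vertex twice,
  so only the changes at the two endpoints of the walk remain.\<close>

lemma card_orientations_reachable:
  assumes "finite_mgraph X" "loopless X" "(adjacent X)\<^sup>*\<^sup>* u v"
  shows "card (orientations X (toggle v (toggle u T))) = card (orientations X T)"
  using assms(3)
proof (induction rule: rtranclp_induct)
  case (step v w)
  have "toggle w (toggle u T) = toggle w (toggle v (toggle v (toggle u T)))"
    by blast
  then show ?case
    using card_orientations_adjacent[OF assms(1,2) step.hyps(2), of "toggle v (toggle u T)"] step.IH
    by simp
qed simp

text \<open>An even set is emptied by removing two vertices at a time; connectedness supplies a walk
  between them, so each removal leaves the count unchanged.\<close>

lemma card_orientations_even:
  assumes "finite_mgraph X" "loopless X" "connected_mgraph X" "T \<subseteq> verts X" "even (card T)"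
  shows "card (orientations X T) = card (orientations X {})"
  using assms(4,5)
proof (induction "card T" arbitrary: T rule: less_induct)
  case less
  have fin: "finite T"
    using less.prems(1) finite_mgraphD(1)[OF assms(1)] finite_subset by blast
  show ?case
  proof (cases "T = {}")
    case False
    then obtain u where u: "u \<in> T"
      by blast
    \<comment> \<open>A set of even size is not the singleton of \<open>u\<close>.\<close>
    have "T - {u} \<noteq> {}"
      using less.prems(2) u by (metis card_1_singleton_iff insert_Diff odd_one One_nat_def)
    then obtain v where v: "v \<in> T" "v \<noteq> u"
      by blast
    have eq: "toggle v (toggle u T) = T - {u, v}"
      using u v by blast
    have card: "card T = card (T - {u, v}) + 2"
      using u v fin card_mono[of T "{u, v}"] by (simp add: card_Diff_subset)
    then have "card (orientations X (T - {u, v})) = card (orientations X {})"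
      using less.prems by (intro less.hyps) auto
    moreover have "(adjacent X)\<^sup>*\<^sup>* u v"
      using assms(3) less.prems(1) u v by (auto simp: connected_mgraph_def)
    ultimately show ?thesis
      using card_orientations_reachable[OF assms(1,2), of u v T] eq by simp
  qed simp
qed

text \<open>All choices of ends are partitioned by their odd sets. These are exactly indexed by the
  even vertex sets, and all classes have the size of the class of the empty set.\<close>

lemma card_even_orientations:
  assumes X: "finite_mgraph X" "loopless X" "connected_mgraph X" and "even (card (edges X))"
  shows "2 ^ card (edges X) = 2 ^ (card (verts X) - 1) * card (orientations X {})"
proof -
  let ?P = "Pi\<^sub>E (edges X) (\<lambda>e. set_mset (ends X e))"
  let ?T = "{T. T \<subseteq> verts X \<and> even (card T)}"
  note fin = finite_mgraphD(1,2)[OF X(1)]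
  have "card (set_mset (ends X e)) = 2" if "e \<in> edges X" for e
    using X(1,2) that by (rule loopless_endsE) simp
  then have "card ?P = 2 ^ card (edges X)"
    using fin by (simp add: card_PiE)
  moreover have "?P = (\<Union>T\<in>?T. orientations X T)"
  proof (intro equalityI subsetI)
    fix \<phi> assume \<phi>: "\<phi> \<in> ?P"
    define T where "T = {v \<in> verts X. odd (card {e \<in> edges X. \<phi> e = v})}"
    \<comment> \<open>The indegrees add up to the number of edges, which is even, so the number of
      odd indegrees is even.\<close>
    have "(\<Sum>v\<in>verts X. card {e \<in> edges X. \<phi> e = v})
        = (\<Sum>v\<in>verts X. \<Sum>e\<in>{e \<in> edges X. \<phi> e = v}. 1)"
      by simp
    also have "\<dots> = (\<Sum>e\<in>edges X. 1)"
      using fin \<phi> finite_mgraphD(4)[OF X(1)] by (intro sum.group) (auto simp: PiE_iff)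
    finally have "even (card T)"
      using assms(4) fin by (simp add: T_def flip: even_sum_iff)
    moreover have "\<phi> \<in> orientations X T"
      using \<phi> by (simp add: orientations_def T_def)
    moreover have "T \<subseteq> verts X"
      by (auto simp: T_def)
    ultimately show "\<phi> \<in> (\<Union>T\<in>?T. orientations X T)"
      by (intro UN_I[of T]) simp_all
  qed (auto simp: orientations_def)
  moreover have "card (\<Union>T\<in>?T. orientations X T) = (\<Sum>T\<in>?T. card (orientations X T))"
  proof (rule card_UN_disjoint)
    show "finite ?T"
      using fin by simp
    show "\<forall>T\<in>?T. finite (orientations X T)"
      using X(1) by (simp add: finite_orientations)
    show "\<forall>S\<in>?T. \<forall>T\<in>?T. S \<noteq> T \<longrightarrow> orientations X S \<inter> orientations X T = {}"
      by (auto simp: orientations_def)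
  qed
  moreover have "(\<Sum>T\<in>?T. card (orientations X T)) = (\<Sum>T\<in>?T. card (orientations X {}))"
    by (rule sum.cong[OF refl]) (rule card_orientations_even[OF X], simp_all)
  ultimately show ?thesis
    using card_even_subsets[OF fin(1)] X(3) by (simp add: connected_mgraph_def)
qed

subsection \<open>Perfect matchings of line graphs\<close>

lemma line_graph_simps [simp]:
  "verts (line_graph X) = edges X"
  "ends (line_graph X) (A, v) = mset_set A"
  by (simp_all add: line_graph_def)

lemma line_graph_edge_iff:
  "(A, v) \<in> edges (line_graph X) \<longleftrightarrow>
    (\<exists>e f. A = {e, f} \<and> e \<noteq> f \<and> e \<in> incident X v \<and> f \<in> incident X v)"
  by (auto simp: line_graph_def incident_def)

lemma line_graph_edgeD:
  assumes "(A, v) \<in> edges (line_graph X)"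
  shows "finite A" "card A = 2" "A \<subseteq> incident X v"
  using assms by (auto simp: line_graph_edge_iff)

lemma line_graph_edgeI:
  assumes "card A = 2" "A \<subseteq> incident X v"
  shows "(A, v) \<in> edges (line_graph X)"
  using assms by (auto simp: line_graph_edge_iff card_2_iff)

text \<open>Multiplicities in \<open>mset_set A\<close> are at most one. This settles the condition
  excluding loops from matchings, both for line graphs and for complete graphs.\<close>

lemma mset_set_not_loop: "mset_set A \<noteq> {#v, v#}"
proof
  assume "mset_set A = {#v, v#}"
  then have "count (mset_set A) v = 2"
    by simp
  then show False
    by (simp add: count_mset_set' split: if_splits)
qed

lemma perfect_matching_line_graph_iff:
  "perfect_matching (line_graph X) F \<longleftrightarrow>
     F \<subseteq> edges (line_graph X) \<and> (\<forall>e\<in>edges X. \<exists>!d. d \<in> F \<and> e \<in> fst d)"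
proof -
  have "(d \<in> F \<and> e \<in># ends (line_graph X) d) \<longleftrightarrow> (d \<in> F \<and> e \<in> fst d)"
    if "F \<subseteq> edges (line_graph X)" for d e
    using that line_graph_edgeD(1)[of "fst d" "snd d" X] by (cases d) auto
  moreover have "ends (line_graph X) d \<noteq> {#v, v#}" for d v
    by (cases d) (simp add: mset_set_not_loop)
  ultimately show ?thesis
    unfolding perfect_matching_def line_graph_simps(1) by (metis (no_types, lifting))
qed

text \<open>An orientation sends every edge to the end at which a matching of the line graph pairs
  it. At vertices of degree at most three an even fibre is empty or a single pair, so the matching
  can be recovered.\<close>

definition orientation_matching :: "('v, 'e) mgraph \<Rightarrow> ('e \<Rightarrow> 'v) \<Rightarrow> ('e set \<times> 'v) set" where
  "orientation_matching X \<phi> = (\<lambda>v. ({e \<in> edges X. \<phi> e = v}, v)) ` (\<phi> ` edges X)"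

text \<open>\<open>orientation_matching X\<close> is a bijection from the orientations with all
  indegrees even onto the perfect matchings. The degree bound enters twice: a nonempty even fibre
  has exactly two edges, and two disjoint pairs at one vertex would need four edges there.\<close>

lemma num_perfect_matchings_line_graph:
  assumes X: "finite_mgraph X" and deg: "\<And>v. v \<in> verts X \<Longrightarrow> card (incident X v) \<le> 3"
  shows "num_perfect_matchings (line_graph X) = card (orientations X {})"
proof -
  let ?fib = "\<lambda>\<phi> v. {e \<in> edges X. \<phi> e = v}"
  have end_vert: "v \<in> verts X" if "e \<in> incident X v" for e v
    using that finite_mgraphD(4)[OF X] by (auto simp: incident_def)
  have fibI: "A = ?fib \<psi> v" if "(A, v) \<in> orientation_matching X \<psi>" for A v \<psi>
    using that by (auto simp: orientation_matching_def)
  have "inj_on (orientation_matching X) (orientations X {})"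
  proof
    fix \<phi> \<psi> assume \<phi>: "\<phi> \<in> orientations X {}" and \<psi>: "\<psi> \<in> orientations X {}"
      and eq: "orientation_matching X \<phi> = orientation_matching X \<psi>"
    have "\<phi> e = \<psi> e" if "e \<in> edges X" for e
    proof -
      have "(?fib \<phi> (\<phi> e), \<phi> e) \<in> orientation_matching X \<phi>"
        using that by (simp add: orientation_matching_def)
      then have "(?fib \<phi> (\<phi> e), \<phi> e) \<in> orientation_matching X \<psi>"
        using eq by simp
      then have "?fib \<phi> (\<phi> e) = ?fib \<psi> (\<phi> e)"
        by (rule fibI)
      moreover have "e \<in> ?fib \<phi> (\<phi> e)"
        using that by simp
      ultimately have "e \<in> ?fib \<psi> (\<phi> e)"
        by (rule subst)
      then show ?thesis
        by simp
    qed
    then show "\<phi> = \<psi>"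
      using \<phi> \<psi> by (intro PiE_ext[of \<phi> "edges X" _ \<psi>]) (auto simp: orientations_def)
  qed
  moreover have "orientation_matching X ` orientations X {} = {F. perfect_matching (line_graph X) F}"
  proof (intro equalityI subsetI)
    fix F assume "F \<in> orientation_matching X ` orientations X {}"
    then obtain \<phi> where \<phi>: "\<phi> \<in> orientations X {}" and F: "F = orientation_matching X \<phi>"
      by blast
    have sub: "?fib \<phi> v \<subseteq> incident X v" for v
      using \<phi> by (auto simp: orientations_def incident_def PiE_iff)
    have "(?fib \<phi> (\<phi> e), \<phi> e) \<in> edges (line_graph X)" if e: "e \<in> edges X" for e
    proof (rule line_graph_edgeI)
      have v: "\<phi> e \<in> verts X"
        using e sub end_vert by blast
      have "card (?fib \<phi> (\<phi> e)) \<le> 3"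
        using deg[OF v] card_mono[OF finite_incident[OF X] sub, of "\<phi> e"] by simp
      moreover have "card (?fib \<phi> (\<phi> e)) \<noteq> 0"
        using e finite_mgraphD(2)[OF X] by auto
      moreover have "even (card (?fib \<phi> (\<phi> e)))"
        using \<phi> v by (simp add: orientations_def)
      moreover have "n = 2" if "n \<le> 3" "n \<noteq> 0" "even n" for n :: nat
        using that by presburger
      ultimately show "card (?fib \<phi> (\<phi> e)) = 2"
        by blast
    qed (rule sub)
    moreover have "\<exists>!d. d \<in> F \<and> e \<in> fst d" if "e \<in> edges X" for e
      using that by (intro ex1I[of _ "(?fib \<phi> (\<phi> e), \<phi> e)"]) (auto simp: F orientation_matching_def)
    ultimately show "F \<in> {F. perfect_matching (line_graph X) F}"
      by (auto simp: perfect_matching_line_graph_iff F orientation_matching_def)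
  next
    fix F assume "F \<in> {F. perfect_matching (line_graph X) F}"
    then have F: "F \<subseteq> edges (line_graph X)" "\<And>e. e \<in> edges X \<Longrightarrow> \<exists>!d. d \<in> F \<and> e \<in> fst d"
      by (auto simp: perfect_matching_line_graph_iff)
    \<comment> \<open>Conversely, each edge is sent to the vertex component of the unique matching
      edge that covers it.\<close>
    define pair where "pair e = (THE d. d \<in> F \<and> e \<in> fst d)" for e
    have pair: "pair e \<in> F" "e \<in> fst (pair e)" if "e \<in> edges X" for e
      using theI'[OF F(2)[OF that]] by (auto simp: pair_def)
    have pair_eq: "pair e = (A, v)" if "(A, v) \<in> F" "e \<in> A" "e \<in> edges X" for e A v
      using that F(2)[OF that(3)] pair[OF that(3)] by (metis fst_conv)
    define \<phi> where "\<phi> = restrict (\<lambda>e. snd (pair e)) (edges X)"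
    have edge: "finite A" "card A = 2" "A \<subseteq> incident X v" if "(A, v) \<in> F" for A v
      using line_graph_edgeD[of A v X] that F(1) by blast+
    have fib: "?fib \<phi> v = A" if Av: "(A, v) \<in> F" for A v
    proof
      show "A \<subseteq> ?fib \<phi> v"
        using edge(3)[OF Av] pair_eq[OF Av] by (auto simp: \<phi>_def incident_def)
      show "?fib \<phi> v \<subseteq> A"
      proof
        fix e assume "e \<in> ?fib \<phi> v"
        then have e: "e \<in> edges X" "pair e = (fst (pair e), v)"
          by (auto simp: \<phi>_def)
        define B where "B = fst (pair e)"
        have B: "(B, v) \<in> F" "e \<in> B"
          using pair[OF e(1)] e(2) by (auto simp: B_def)
        have "A = B"
        \<comment> \<open>Distinct matching edges cover disjoint pairs. Two of them at
          \<open>v\<close> would give four edges incident with \<open>v\<close>.\<close>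
        proof (rule ccontr)
          assume "A \<noteq> B"
          then have "A \<inter> B = {}"
            using pair_eq[OF Av] pair_eq[OF B(1)] edge(3)[OF Av]
            by (auto simp: incident_def) (metis Pair_inject subsetD mem_Collect_eq)+
          then have "card (A \<union> B) = 4"
            using edge(1,2)[OF Av] edge(1,2)[OF B(1)] by (simp add: card_Un_disjoint)
          moreover have "card (A \<union> B) \<le> card (incident X v)"
            using edge(3)[OF Av] edge(3)[OF B(1)] finite_incident[OF X] by (intro card_mono) auto
          moreover have "v \<in> verts X"
            using end_vert edge(3)[OF B(1)] B(2) by blast
          ultimately show False
            using deg by fastforce
        qed
        then show "e \<in> A"
          using B by simp
      qed
    qed
    have pair_fib: "pair e = (?fib \<phi> (\<phi> e), \<phi> e)" if e: "e \<in> edges X" for e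
    proof -
      obtain A v where Av: "pair e = (A, v)"
        by fastforce
      then have "(A, v) \<in> F" "\<phi> e = v"
        using pair(1)[OF e] e by (auto simp: \<phi>_def)
      then show ?thesis
        using Av fib by simp
    qed
    have "\<phi> \<in> orientations X {}"
      unfolding orientations_def
    proof (intro CollectI conjI ballI)
      show "\<phi> \<in> Pi\<^sub>E (edges X) (\<lambda>e. set_mset (ends X e))"
      proof
        fix e assume e: "e \<in> edges X"
        then have "e \<in> ?fib \<phi> (\<phi> e)" "(?fib \<phi> (\<phi> e), \<phi> e) \<in> F"
          using pair(1)[OF e] pair_fib[OF e] by auto
        then show "\<phi> e \<in> set_mset (ends X e)"
          using edge(3) by (fastforce simp: incident_def)
      qed (simp add: \<phi>_def)
      show "odd (card (?fib \<phi> v)) \<longleftrightarrow> v \<in> {}" for v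
      \<comment> \<open>A fibre is empty or one of the matched pairs, and is even in either
        case.\<close>
      proof (cases "?fib \<phi> v = {}")
        case True
        show ?thesis
          unfolding True by simp
      next
        case False
        then obtain e where "e \<in> edges X" "\<phi> e = v"
          by blast
        then have "(?fib \<phi> v, v) \<in> F"
          using pair(1) pair_fib by metis
        then have "card (?fib \<phi> v) = 2"
          by (rule edge(2))
        then show ?thesis
          by simp
      qed
    qed
    moreover have "F = orientation_matching X \<phi>"
    proof (intro equalityI subsetI)
      fix d assume d: "d \<in> F"
      obtain A v where Av: "d = (A, v)"
        by fastforce
      then have "A = ?fib \<phi> v" "A \<noteq> {}"
        using d fib edge(2)[of A v] by auto
      then show "d \<in> orientation_matching X \<phi>"
        by (auto simp: orientation_matching_def Av)
    next
      fix d assume "d \<in> orientation_matching X \<phi>"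
      then obtain e where "e \<in> edges X" "d = (?fib \<phi> (\<phi> e), \<phi> e)"
        by (auto simp: orientation_matching_def)
      then show "d \<in> F"
        using pair(1) pair_fib by metis
    qed
    ultimately show "F \<in> orientation_matching X ` orientations X {}"
      by blast
  qed
  ultimately show ?thesis
    unfolding num_perfect_matchings_def by (metis card_image)
qed

subsection \<open>Line graphs and vertex degrees\<close>

lemma finite_mgraph_line_graph:
  assumes "finite_mgraph X"
  shows "finite_mgraph (line_graph X)"
proof -
  have "edges (line_graph X) \<subseteq> Pow (edges X) \<times> verts X"
    using finite_mgraphD(4)[OF assms] by (auto simp: line_graph_def)
  then have "finite (edges (line_graph X))"
    using finite_mgraphD(1,2)[OF assms] by (meson finite_Pow_iff finite_SigmaI finite_subset)
  moreover have "size (ends (line_graph X) d) = 2 \<and> set_mset (ends (line_graph X) d) \<subseteq> edges X"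
    if "d \<in> edges (line_graph X)" for d
    using that line_graph_edgeD[of "fst d" "snd d" X] by (cases d) (auto simp: incident_def)
  ultimately show ?thesis
    using finite_mgraphD(2)[OF assms] by (simp add: finite_mgraph_def)
qed

text \<open>An edge of the line graph records a pair of edges together with a common end, so the
  edge map acts on the first component and the vertex map on the second.\<close>

lemma line_graph_iso:
  assumes "finite_mgraph X" "X \<simeq> Y"
  shows "line_graph X \<simeq> line_graph Y"
proof -
  obtain f g where fg: "bij_betw f (verts X) (verts Y)" "bij_betw g (edges X) (edges Y)"
    "\<And>e. e \<in> edges X \<Longrightarrow> ends Y (g e) = image_mset f (ends X e)"
    using mgraph_isoE[OF assms(2)] by blast
  have vert: "v \<in> verts X" if "e \<in> incident X v" for e v
    using that finite_mgraphD(4)[OF assms(1)] by (auto simp: incident_def)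
  have edge: "A \<subseteq> edges X" "A \<noteq> {}" "v \<in> verts X" "A \<subseteq> incident X v"
    if "(A, v) \<in> edges (line_graph X)" for A v
    using that vert by (auto simp: line_graph_edge_iff incident_def)
  have inc: "g e \<in> incident Y (f v) \<longleftrightarrow> e \<in> incident X v" if "e \<in> edges X" "v \<in> verts X" for e v
    using that fg(3)[OF that(1)] bij_betwE[OF fg(2)] mem_ends_iso[OF assms(1) fg(1) that]
    by (simp add: incident_def)
  have inj: "inj_on g (edges X)" "inj_on f (verts X)"
    using fg by (auto simp: bij_betw_def)
  show ?thesis
  proof (rule mgraph_isoI)
    show "bij_betw g (verts (line_graph X)) (verts (line_graph Y))"
      using fg(2) by simp
    show "bij_betw (map_prod (image g) f) (edges (line_graph X)) (edges (line_graph Y))"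
    proof (rule bij_betw_imageI)
      show "inj_on (map_prod (image g) f) (edges (line_graph X))"
      proof
        fix d d' assume d: "d \<in> edges (line_graph X)" "d' \<in> edges (line_graph X)"
          and eq: "map_prod (image g) f d = map_prod (image g) f d'"
        obtain A v B w where "d = (A, v)" "d' = (B, w)"
          by (cases d, cases d')
        then show "d = d'"
          using d eq edge inj_on_image_eq_iff[OF inj(1), of A B] inj_onD[OF inj(2), of v w] by simp
      qed
      show "map_prod (image g) f ` edges (line_graph X) = edges (line_graph Y)"
      proof (intro equalityI subsetI)
        fix d assume "d \<in> map_prod (image g) f ` edges (line_graph X)"
        then obtain A v where A: "(A, v) \<in> edges (line_graph X)" and d: "d = (g ` A, f v)"
          by auto
        have "card (g ` A) = 2"
          using line_graph_edgeD(2)[OF A] edge(1)[OF A] inj(1) by (metis card_image inj_on_subset)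
        moreover have "g ` A \<subseteq> incident Y (f v)"
        proof
          fix e assume "e \<in> g ` A"
          then obtain a where "a \<in> A" "e = g a" by blast
          then show "e \<in> incident Y (f v)"
            using inc[OF _ edge(3)[OF A], of a] edge(1,4)[OF A] by blast
        qed
        ultimately show "d \<in> edges (line_graph Y)"
          unfolding d by (rule line_graph_edgeI)
      next
        fix d assume d: "d \<in> edges (line_graph Y)"
        obtain B w where Bw: "d = (B, w)"
          by fastforce
        have B: "(B, w) \<in> edges (line_graph Y)"
          using d Bw by simp
        define A where "A = {e \<in> edges X. g e \<in> B}"
        have BY: "B \<subseteq> edges Y"
          using line_graph_edgeD(3)[OF B] by (auto simp: incident_def)
        have gA: "g ` A = B"
          using BY fg(2) by (auto simp: A_def bij_betw_def)
        have "A \<subseteq> edges X"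
          by (auto simp: A_def)
        then have cA: "card A = 2"
          using line_graph_edgeD(2)[OF B] gA inj(1) by (metis card_image inj_on_subset)
        then obtain a where a: "a \<in> A"
          by fastforce
        then have "g a \<in> incident Y w" "a \<in> edges X"
          using line_graph_edgeD(3)[OF B] by (auto simp: A_def)
        \<comment> \<open>Since \<open>w\<close> is an end of the image of \<open>a\<close>, it is
          the image of an end \<open>v\<close> of \<open>a\<close>; this \<open>v\<close> is the
          second component of the preimage.\<close>
        then obtain v where v: "v \<in># ends X a" "w = f v"
          using fg(3) by (auto simp: incident_def)
        have vX: "v \<in> verts X"
          using finite_mgraphD(4)[OF assms(1) \<open>a \<in> edges X\<close> v(1)] .
        have "A \<subseteq> incident X v"
        proof
          fix e assume "e \<in> A"
          then show "e \<in> incident X v"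
            using inc[OF _ vX, of e] v(2) line_graph_edgeD(3)[OF B] by (auto simp: A_def)
        qed
        with cA have "(A, v) \<in> edges (line_graph X)"
          by (rule line_graph_edgeI)
        moreover have "d = map_prod (image g) f (A, v)"
          using Bw gA v(2) by simp
        ultimately show "d \<in> map_prod (image g) f ` edges (line_graph X)"
          by (rule rev_image_eqI)
      qed
    qed
    show "ends (line_graph Y) (map_prod (image g) f d) = image_mset g (ends (line_graph X) d)"
      if d: "d \<in> edges (line_graph X)" for d
    proof -
      obtain A v where Av: "d = (A, v)"
        by fastforce
      then have "A \<subseteq> edges X"
        using d edge(1)[of A v] by simp
      then have "inj_on g A"
        by (rule inj_on_subset[OF inj(1)])
      then show ?thesis
        by (simp add: Av image_mset_mset_set)
    qed
  qed
qed

text \<open>Each end \<open>w\<close> of \<open>e\<close> contributes one edge for every other edge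
  at \<open>w\<close>. The two contributions are disjoint because \<open>w\<close> is part of the
  edge name, so an edge parallel to \<open>e\<close> counts twice. The summand 2 on the left avoids
  truncated subtraction.\<close>

lemma degree_line_graph:
  assumes X: "finite_mgraph X" "loopless X" and e: "e \<in> edges X" "ends X e = {#u, v#}"
  shows "degree (line_graph X) e + 2 = card (incident X u) + card (incident X v)"
proof -
  have uv: "u \<noteq> v"
    using X(2) e by (auto simp: loopless_def)
  have e_inc: "e \<in> incident X u" "e \<in> incident X v"
    using e by (simp_all add: incident_def)
  let ?at = "\<lambda>w. (\<lambda>f. ({e, f}, w)) ` (incident X w - {e})"
  have "count (ends (line_graph X) d) e = (if e \<in> fst d then 1 else 0)"
    if "d \<in> edges (line_graph X)" for d
    using that line_graph_edgeD(1)[of "fst d" "snd d" X] by (cases d) (simp add: count_mset_set')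
  then have "degree (line_graph X) e = (\<Sum>d\<in>edges (line_graph X). if e \<in> fst d then 1 else 0)"
    unfolding degree_def by (rule sum.cong[OF refl])
  also have "\<dots> = card {d \<in> edges (line_graph X). e \<in> fst d}"
    using finite_mgraphD(2)[OF finite_mgraph_line_graph[OF X(1)]] by (simp add: sum.If_cases Int_def)
  also have "{d \<in> edges (line_graph X). e \<in> fst d} = ?at u \<union> ?at v"
  proof (intro equalityI subsetI)
    fix d assume "d \<in> {d \<in> edges (line_graph X). e \<in> fst d}"
    then obtain A w where d: "d = (A, w)" "(A, w) \<in> edges (line_graph X)" "e \<in> A"
      by (cases d) auto
    then obtain f where f: "A = {e, f}" "e \<noteq> f" "f \<in> incident X w" "e \<in> incident X w"
      by (auto simp: line_graph_edge_iff)
    then have "w = u \<or> w = v"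
      using e by (auto simp: incident_def)
    then show "d \<in> ?at u \<union> ?at v"
      using d f by blast
  next
    fix d assume "d \<in> ?at u \<union> ?at v"
    then obtain w f where "d = ({e, f}, w)" "w = u \<or> w = v" "f \<in> incident X w" "f \<noteq> e"
      by blast
    then show "d \<in> {d \<in> edges (line_graph X). e \<in> fst d}"
      using e_inc by (auto simp: line_graph_edge_iff)
  qed
  also have "card (?at u \<union> ?at v) = card (?at u) + card (?at v)"
    using uv finite_incident[OF X(1)] by (intro card_Un_disjoint) auto
  finally have "degree (line_graph X) e = card (?at u) + card (?at v)" .
  moreover have "card (?at w) = card (incident X w - {e})" for w
    by (rule card_image) (auto simp: inj_on_def doubleton_eq_iff)
  ultimately show ?thesis
    using card.remove[OF finite_incident[OF X(1)] e_inc(1)] card.remove[OF finite_incident[OF X(1)] e_inc(2)]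
    by simp
qed

subsection \<open>Stars and the complete graph on four vertices\<close>

text \<open>The neighbours of a vertex \<open>u\<close> of degree four have degree one, so by
  connectedness nothing lies beyond them. Thus H is a star with four edges, and any two of its edges
  meet at \<open>u\<close> and nowhere else.\<close>

lemma line_graph_star:
  assumes X: "finite_mgraph X" "loopless X" "connected_mgraph X"
    and five: "\<And>e u v. e \<in> edges X \<Longrightarrow> ends X e = {#u, v#} \<Longrightarrow>
      card (incident X u) + card (incident X v) = 5"
    and u: "u \<in> verts X" "card (incident X u) = 4"
  shows "line_graph X \<simeq> complete_graph 4"
proof -
  have leaf: "incident X w = {e}" if "e \<in> edges X" "ends X e = {#u, w#}" for e w
  proof -
    have "card (incident X w) = 1"
      using five[OF that] u(2) by simp
    moreover have "e \<in> incident X w"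
      using that by (simp add: incident_def)
    ultimately show ?thesis
      by (auto simp: card_1_singleton_iff)
  qed
  \<comment> \<open>Invariant along walks from \<open>u\<close>: the walk is at \<open>u\<close> or
    at a leaf, and the only edge at a leaf leads back to \<open>u\<close>.\<close>
  have reach: "x = u \<or> (\<exists>e\<in>incident X u. incident X x = {e})" if "(adjacent X)\<^sup>*\<^sup>* u x" for x
    using that
  proof (induction rule: rtranclp_induct)
    case (step x y)
    obtain d where d: "d \<in> edges X" "ends X d = {#x, y#}"
      using step.hyps(2) by (auto simp: adjacent_def)
    show ?case
    proof (cases "x = u")
      case True
      then have "d \<in> incident X u" "incident X y = {d}"
        using d leaf[of d y] by (simp_all add: incident_def)
      then show ?thesis
        by blast
    next
      case False
      then obtain e where "e \<in> incident X u" "incident X x = {e}"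
        using step.IH by blast
      moreover have "d \<in> incident X x"
        using d by (simp add: incident_def)
      ultimately have "u \<in># ends X d"
        by (simp add: incident_def)
      then show ?thesis
        using d False by auto
    qed
  qed simp
  have leaves: "x = u \<or> (\<exists>e\<in>incident X u. incident X x = {e})" if "x \<in> verts X" for x
    using reach X(3) u(1) that by (simp add: connected_mgraph_def)
  have star: "edges X = incident X u"
  proof
    show "edges X \<subseteq> incident X u"
    proof
      fix e assume e: "e \<in> edges X"
      obtain x y where xy: "ends X e = {#x, y#}" "x \<noteq> y" "x \<in> verts X" "y \<in> verts X"
        using X(1,2) e by (rule loopless_endsE)
      then have "e \<in> incident X x"
        using e by (simp add: incident_def)
      then show "e \<in> incident X u"
        using leaves[OF xy(3)] by auto
    qed
  qed (auto simp: incident_def)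
  have edges: "edges (line_graph X) = (\<lambda>A. (A, u)) ` {A. A \<subseteq> edges X \<and> card A = 2}"
  proof (intro equalityI subsetI)
    fix d assume d: "d \<in> edges (line_graph X)"
    obtain A v where Av: "d = (A, v)"
      by fastforce
    then have A: "card A = 2" "A \<subseteq> incident X v" "finite A"
      using line_graph_edgeD[of A v X] d by auto
    \<comment> \<open>At a leaf there is only one edge, hence no pair of distinct edges.\<close>
    have "v = u"
    proof (rule ccontr)
      assume "v \<noteq> u"
      obtain a where "a \<in> incident X v"
        using A by fastforce
      then have "v \<in> verts X"
        using finite_mgraphD(4)[OF X(1)] by (auto simp: incident_def)
      then obtain e where "incident X v = {e}"
        using leaves \<open>v \<noteq> u\<close> by blast
      then show False
        using A card_mono[of "{e}" A] by simp
    qed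
    then show "d \<in> (\<lambda>A. (A, u)) ` {A. A \<subseteq> edges X \<and> card A = 2}"
      using Av A star by simp
  qed (auto intro!: line_graph_edgeI simp: star)
  have "card (edges X) = 4"
    using star u(2) by simp
  then obtain h where h: "bij_betw h (edges X) {..<4::nat}"
    using ex_bij_betw_finite_nat[OF finite_mgraphD(2)[OF X(1)]] by (auto simp: atLeast0LessThan)
  then have inj: "inj_on h (edges X)" and im: "h ` edges X = {..<4}"
    by (auto simp: bij_betw_def)
  show ?thesis
  proof (rule mgraph_isoI[of h _ _ "\<lambda>(A, v). h ` A"])
    show "bij_betw h (verts (line_graph X)) (verts (complete_graph 4))"
      using h by (simp add: complete_graph_def)
    show "bij_betw (\<lambda>(A, v). h ` A) (edges (line_graph X)) (edges (complete_graph 4))"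
    proof (rule bij_betw_imageI)
      show "inj_on (\<lambda>(A, v). h ` A) (edges (line_graph X))"
        using inj by (auto simp: edges inj_on_def[of _ "_ ` _"] inj_on_image_eq_iff)
      show "(\<lambda>(A, v). h ` A) ` edges (line_graph X) = edges (complete_graph 4)"
      proof (intro equalityI subsetI)
        fix B assume "B \<in> (\<lambda>(A, v). h ` A) ` edges (line_graph X)"
        then obtain A where A: "A \<subseteq> edges X" "card A = 2" "B = h ` A"
          by (auto simp: edges)
        then have "card B = 2"
          using inj by (metis card_image inj_on_subset)
        then show "B \<in> edges (complete_graph 4)"
          using A im by (auto simp: complete_graph_def)
      next
        fix B assume "B \<in> edges (complete_graph 4)"
        then have B: "B \<subseteq> {..<4}" "card B = 2"
          by (simp_all add: complete_graph_def)
        then obtain A where A: "A \<subseteq> edges X" "B = h ` A"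
          using im by (metis subset_imageE)
        then have "card A = 2"
          using B inj by (metis card_image inj_on_subset)
        then show "B \<in> (\<lambda>(A, v). h ` A) ` edges (line_graph X)"
          unfolding edges A(2) using A(1) by (intro image_eqI[of _ _ "(A, u)"]) auto
      qed
    qed
    show "ends (complete_graph 4) ((\<lambda>(A, v). h ` A) d) = image_mset h (ends (line_graph X) d)"
      if d: "d \<in> edges (line_graph X)" for d
    proof -
      obtain A where A: "d = (A, u)" "A \<subseteq> edges X"
        using d by (auto simp: edges)
      have "inj_on h A"
        using inj A(2) by (rule inj_on_subset)
      then show ?thesis
        by (simp add: A(1) complete_graph_def image_mset_mset_set)
    qed
  qed
qed

text \<open>A perfect matching is determined by the partner of vertex 0, because the two remaining
  vertices must then be matched with each other.\<close>

lemma complete_graph_4_matchings: "num_perfect_matchings (complete_graph 4) = 3"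
proof -
  let ?M = "{{{0, 1}, {2, 3}}, {{0, 2}, {1, 3}}, {{0, 3}, {1, 2}}} :: nat set set set"
  have V: "{..<4::nat} = {0, 1, 2, 3}"
    by auto
  have match: "perfect_matching (complete_graph 4) F \<longleftrightarrow>
      (\<forall>A\<in>F. A \<subseteq> {0, 1, 2, 3} \<and> card A = 2) \<and> (\<forall>v\<in>{0, 1, 2, 3}. \<exists>!A. A \<in> F \<and> v \<in> A)" for F
  proof -
    have "(A \<in> F \<and> v \<in># mset_set A) \<longleftrightarrow> (A \<in> F \<and> v \<in> A)" if "\<forall>A\<in>F. card A = 2" for A v
    proof (cases "A \<in> F")
      case True
      then have "finite A"
        using that by (intro card_ge_0_finite) simp
      then show ?thesis
        by simp
    qed simp
    then show ?thesis
      unfolding perfect_matching_def complete_graph_def V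
      by (cases "\<forall>A\<in>F. card A = 2") (auto simp only: mset_set_not_loop mgraph.simps)
  qed
  have "{F. perfect_matching (complete_graph 4) F} = ?M"
  proof (intro equalityI subsetI)
    fix F assume "F \<in> {F. perfect_matching (complete_graph 4) F}"
    then have F: "\<And>A. A \<in> F \<Longrightarrow> A \<subseteq> {0, 1, 2, 3} \<and> card A = 2"
      "\<And>v. v \<in> {0, 1, 2, 3} \<Longrightarrow> \<exists>!A. A \<in> F \<and> v \<in> A"
      by (auto simp: match)
    have other: "\<exists>w. w \<in> {0, 1, 2, 3} \<and> w \<noteq> v \<and> {v, w} \<in> F" if v: "v \<in> {0, 1, 2, 3}" for v
    proof -
      obtain A where A: "A \<in> F" "v \<in> A"
        using F(2)[OF v] by blast
      then obtain w where "A = {v, w}" "w \<noteq> v"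
        using F(1)[OF A(1)] by (auto simp: card_2_iff)
      then show ?thesis
        using A F(1) by blast
    qed
    have eq: "A = B" if "A \<in> F" "B \<in> F" "v \<in> A" "v \<in> B" for A B v
      using F(1)[OF that(1)] F(2)[of v] that by blast
    \<comment> \<open>The partner of \<open>c\<close> is neither \<open>a\<close> nor
      \<open>b\<close>, which are already covered, so it is \<open>d\<close>. Any further edge would
      meet one of these two edges and hence be equal to it.\<close>
    have exhaust: "F = {{a, b}, {c, d}}"
      if ab: "{a, b} \<in> F" and set: "{a, b, c, d} = {0, 1, 2, 3}" "distinct [a, b, c, d]" for a b c d
    proof -
      obtain w where w: "w \<in> {0, 1, 2, 3}" "w \<noteq> c" "{c, w} \<in> F"
        using other[of c] set(1) by blast
      have "w = d"
      proof (rule ccontr)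
        assume "w \<noteq> d"
        then have "w \<in> {a, b}"
          using w set(1) by blast
        then have "{c, w} = {a, b}"
          using eq[OF w(3) ab, of w] by simp
        then show False
          using set(2) by auto
      qed
      then have cd: "{c, d} \<in> F"
        using w by simp
      have "A = {a, b} \<or> A = {c, d}" if A: "A \<in> F" for A
      proof -
        obtain x where x: "x \<in> A" "x \<in> {a, b, c, d}"
          using F(1)[OF A] set(1) by (metis card.empty equals0I subsetD zero_neq_numeral)
        then show ?thesis
          using eq[OF A ab x(1)] eq[OF A cd x(1)] by blast
      qed
      then show ?thesis
        using ab cd by blast
    qed
    obtain w where w: "w \<in> {0, 1, 2, 3}" "w \<noteq> 0" "{0, w} \<in> F"
      using other[of 0] by blast
    then consider "{0, 1} \<in> F" | "{0, 2} \<in> F" | "{0, 3} \<in> F"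
      by auto
    then show "F \<in> ?M"
    proof cases
      case 1
      then have "F = {{0, 1}, {2, 3}}"
        by (rule exhaust) auto
      then show ?thesis by simp
    next
      case 2
      then have "F = {{0, 2}, {1, 3}}"
        by (rule exhaust) auto
      then show ?thesis by simp
    next
      case 3
      then have "F = {{0, 3}, {1, 2}}"
        by (rule exhaust) auto
      then show ?thesis by simp
    qed
  next
    have pm: "{{a, b}, {c, d}} \<in> {F. perfect_matching (complete_graph 4) F}"
      if "{a, b, c, d} = {0, 1, 2, 3}" "distinct [a, b, c, d]" for a b c d :: nat
      unfolding mem_Collect_eq match that(1)[symmetric] using that(2) by auto
    fix F assume "F \<in> ?M"
    then show "F \<in> {F. perfect_matching (complete_graph 4) F}"
      using pm[of 0 1 2 3] pm[of 0 2 1 3] pm[of 0 3 1 2] by auto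
  qed
  moreover have "card ?M = 3"
    by (simp add: doubleton_eq_iff)
  ultimately show ?thesis
    by (simp add: num_perfect_matchings_def)
qed

subsection \<open>Bipartite graphs with degrees two and three\<close>

text \<open>Double counting: each edge of \<open>E\<close> is counted once, at its only end in
  \<open>W\<close>. It is used with all edges to compare the two vertex classes, and with the edges
  at one vertex to compute a degree of the reduced graph.\<close>

lemma sum_incident_transversal:
  assumes X: "finite_mgraph X" and W: "W \<subseteq> verts X"
    and ex1: "\<And>e. e \<in> E \<Longrightarrow> \<exists>!v. v \<in> W \<and> v \<in># ends X e" and "E \<subseteq> edges X"
  shows "(\<Sum>v\<in>W. card (E \<inter> incident X v)) = card E"
proof -
  have fin: "finite W" "finite E"
    using W finite_mgraphD(1,2)[OF X] assms(4) finite_subset by blast+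
  have "E = (\<Union>v\<in>W. E \<inter> incident X v)"
    using ex1 assms(4) by (fastforce simp: incident_def)
  moreover have "card (\<Union>v\<in>W. E \<inter> incident X v) = (\<Sum>v\<in>W. card (E \<inter> incident X v))"
    using fin ex1 by (intro card_UN_disjoint) (auto simp: incident_def)
  ultimately show ?thesis
    by simp
qed

text \<open>Deleting \<open>w\<close> once from each of its two edges leaves the far ends, that is,
  the ends of the edge obtained by suppressing \<open>w\<close>. They coincide when the two edges
  are parallel.\<close>

lemma incident_other_ends:
  assumes X: "finite_mgraph X" "loopless X" and w: "card (incident X w) = 2"
  obtains x y where "(\<Sum>e\<in>incident X w. ends X e - {#w#}) = {#x, y#}"
    "\<exists>d\<in>edges X. ends X d = {#w, x#}" "\<exists>e\<in>edges X. ends X e = {#w, y#}"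
proof -
  obtain d e where de: "incident X w = {d, e}" "d \<noteq> e"
    using w by (auto simp: card_2_iff)
  have other: "\<exists>x. ends X a = {#w, x#}" if "a \<in> incident X w" for a
    using that finite_mgraphD(3)[OF X(1), of a]
    by (auto simp: incident_def size_eq_two_iff add_mset_commute)
  obtain x where "ends X d = {#w, x#}"
    using other[of d] de(1) by auto
  moreover obtain y where "ends X e = {#w, y#}"
    using other[of e] de(1) by auto
  moreover have "d \<in> edges X" "e \<in> edges X"
    using de(1) by (auto simp: incident_def)
  ultimately show thesis
    using de by (intro that[of x y]) auto
qed

text \<open>Without loops, an edge at \<open>w\<close> contributes one to the multiplicity of
  \<open>v\<close> exactly if it joins \<open>w\<close> to \<open>v\<close>. The multiplicity is
  therefore the number of parallel edges between the two vertices.\<close>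

lemma count_other_ends:
  assumes X: "finite_mgraph X" "loopless X" and vw: "v \<noteq> w"
  shows "count (\<Sum>e\<in>incident X w. ends X e - {#w#}) v = card (incident X v \<inter> incident X w)"
proof -
  have one: "count (ends X e - {#w#}) v = (if e \<in> incident X v then 1 else 0)"
    if e: "e \<in> incident X w" for e
  proof -
    have eE: "e \<in> edges X"
      using e by (simp add: incident_def)
    obtain x y where "ends X e = {#x, y#}" "x \<noteq> y"
      using X eE by (rule loopless_endsE)
    then show ?thesis
      using vw eE by (auto simp: incident_def)
  qed
  have "count (\<Sum>e\<in>incident X w. ends X e - {#w#}) v
      = (\<Sum>e\<in>incident X w. count (ends X e - {#w#}) v)"
    by (simp add: count_sum)
  also have "\<dots> = (\<Sum>e\<in>incident X w. if e \<in> incident X v then 1 else 0)"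
    using one by (rule sum.cong[OF refl])
  also have "\<dots> = card (incident X v \<inter> incident X w)"
    using finite_incident[OF X(1)] by (simp add: sum.If_cases Int_commute)
  finally show ?thesis .
qed

text \<open>The case that remains when H is not a star; the locale is later interpreted with the
  sets of vertices of degree two and of degree three.\<close>

locale two_three_bipartite =
  fixes H :: "('v, 'e) mgraph" and V2 V3 :: "'v set"
  assumes fin: "finite_mgraph H" and loopless: "loopless H" and connected: "connected_mgraph H"
    and verts: "verts H = V2 \<union> V3" and disjoint: "V2 \<inter> V3 = {}"
    and deg2: "v \<in> V2 \<Longrightarrow> card (incident H v) = 2"
    and deg3: "v \<in> V3 \<Longrightarrow> card (incident H v) = 3"
    and bipartite: "e \<in> edges H \<Longrightarrow> \<exists>w\<in>V2. \<exists>v\<in>V3. ends H e = {#w, v#}"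
begin

lemma ex1_ends:
  assumes "e \<in> edges H"
  shows "\<exists>!v. v \<in> V2 \<and> v \<in># ends H e" "\<exists>!v. v \<in> V3 \<and> v \<in># ends H e"
proof -
  obtain w v where wv: "w \<in> V2" "v \<in> V3" "ends H e = {#w, v#}"
    using bipartite[OF assms] by blast
  then have "w \<notin> V3" "v \<notin> V2"
    using disjoint by auto
  with wv show "\<exists>!v. v \<in> V2 \<and> v \<in># ends H e" "\<exists>!v. v \<in> V3 \<and> v \<in># ends H e"
    by (intro ex1I[of _ w] ex1I[of _ v]; auto)+
qed

lemma card_edges: "card (edges H) = 2 * card V2" "card (edges H) = 3 * card V3"
proof -
  have "edges H \<inter> incident H v = incident H v" for v
    by (auto simp: incident_def)
  then show "card (edges H) = 2 * card V2" "card (edges H) = 3 * card V3"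
    using sum_incident_transversal[OF fin, of V2 "edges H"]
      sum_incident_transversal[OF fin, of V3 "edges H"] ex1_ends verts deg2 deg3
    by (simp_all add: mult.commute)
qed

lemma num_perfect_matchings:
  assumes "edges H \<noteq> {}"
  shows "real (num_perfect_matchings (line_graph H)) = 2 powr (real (card (edges H)) / 6 + 1)"
proof -
  \<comment> \<open>Counting edges from both sides gives 2 |V2| = 3 |V3|, so |V3| is even. In terms
    of k there are 6k edges and 5k vertices, and the exponent m - n + 1 becomes k + 1.\<close>
  obtain k where k: "card V3 = 2 * k"
    using card_edges by (metis dvdE dvd_triv_left even_mult_iff odd_numeral)
  then have V2: "card V2 = 3 * k" and E: "card (edges H) = 6 * k"
    using card_edges by auto
  have "k > 0"
    using E assms finite_mgraphD(2)[OF fin] by (cases k) auto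
  have "card (verts H) = 5 * k"
    using finite_mgraphD(1)[OF fin] disjoint V2 k by (simp add: verts card_Un_disjoint)
  then have "2 ^ (6 * k) = 2 ^ (5 * k - 1) * card (orientations H {})"
    using card_even_orientations[OF fin loopless connected] E by simp
  \<comment> \<open>Positivity of k makes the truncated difference 5k - 1 an honest one.\<close>
  moreover have "6 * k = (5 * k - 1) + (k + 1)"
    using \<open>k > 0\<close> by simp
  ultimately have "(2::nat) ^ (5 * k - 1) * 2 ^ (k + 1) = 2 ^ (5 * k - 1) * card (orientations H {})"
    by (metis power_add)
  then have "card (orientations H {}) = 2 ^ (k + 1)"
    by simp
  moreover have "num_perfect_matchings (line_graph H) = card (orientations H {})"
    using deg2 deg3 by (intro num_perfect_matchings_line_graph fin) (auto simp: verts)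
  ultimately show ?thesis
    using E by (simp add: powr_realpow powr_add)
qed

text \<open>This is the graph G^+: every vertex of degree two is suppressed and itself serves as the
  name of the new edge between its neighbours. Two parallel edges of H at such a vertex give a
  loop.\<close>

definition base :: "('v, 'v) mgraph" where
  "base = \<lparr>verts = V3, edges = V2, ends = (\<lambda>w. \<Sum>e\<in>incident H w. ends H e - {#w#})\<rparr>"

lemma base_simps [simp]:
  "verts base = V3" "edges base = V2" "ends base w = (\<Sum>e\<in>incident H w. ends H e - {#w#})"
  by (simp_all add: base_def)

lemma V3_other_end:
  assumes "w \<in> V2" "e \<in> edges H" "ends H e = {#w, x#}"
  shows "x \<in> V3"
proof -
  obtain w' v where wv: "w' \<in> V2" "v \<in> V3" "{#w, x#} = {#w', v#}"
    using bipartite[OF assms(2)] assms(3) by auto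
  then have "w \<in># {#w', v#}"
    by (metis union_single_eq_member)
  then have "w = w'"
    using assms(1) wv(2) disjoint by auto
  then show ?thesis
    using wv by simp
qed

lemma ends_baseE:
  assumes "w \<in> V2"
  obtains x y where "ends base w = {#x, y#}" "x \<in> V3" "y \<in> V3"
proof -
  obtain x y where "ends base w = {#x, y#}"
    "\<exists>d\<in>edges H. ends H d = {#w, x#}" "\<exists>e\<in>edges H. ends H e = {#w, y#}"
    using incident_other_ends[OF fin loopless deg2[OF assms]] by (metis base_simps(3))
  then show thesis
    using V3_other_end[OF assms] that by blast
qed

lemma count_ends_base:
  assumes "w \<in> V2" "v \<in> V3"
  shows "count (ends base w) v = card (incident H v \<inter> incident H w)"
proof -
  have "v \<noteq> w"
    using assms disjoint by blast
  then show ?thesis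
    using count_other_ends[OF fin loopless] by simp
qed

text \<open>The multiplicity of \<open>v\<close> in the edge \<open>w\<close> is the number of edges
  of H between them, so summing over \<open>V2\<close> gives the degree of \<open>v\<close> in H,
  which is three. For connectedness, two steps of a walk in H through a vertex of \<open>V2\<close>
  either return to their start or form one edge of \<open>base\<close>.\<close>

lemma connected_cubic_base:
  assumes "edges H \<noteq> {}"
  shows "connected_cubic base"
  unfolding connected_cubic_def
proof (intro conjI)
  have "finite V2" "finite V3"
    using finite_mgraphD(1)[OF fin] by (simp_all add: verts)
  moreover have "size (ends base w) = 2 \<and> set_mset (ends base w) \<subseteq> V3" if "w \<in> V2" for w
    using that by (rule ends_baseE) (simp del: base_simps(3))
  ultimately show "finite_mgraph base"
    by (simp add: finite_mgraph_def del: base_simps(3))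
  show "cubic base"
    unfolding cubic_def
  proof
    fix v assume "v \<in> verts base"
    then have v: "v \<in> V3"
      by simp
    have "degree base v = (\<Sum>w\<in>V2. card (incident H v \<inter> incident H w))"
      unfolding degree_def base_simps(2) using count_ends_base v by (intro sum.cong) simp_all
    also have "\<dots> = card (incident H v)"
      using ex1_ends(1) by (intro sum_incident_transversal[OF fin]) (auto simp: verts incident_def)
    finally show "degree base v = 3"
      using deg3[OF v] by simp
  qed
  \<comment> \<open>A walk may pause at a vertex of \<open>V2\<close>, which is not a vertex of
    \<open>base\<close>. There the invariant says instead that all its neighbours in
    \<open>V3\<close> are reachable.\<close>
  have reach: "if x \<in> V3 then (adjacent base)\<^sup>*\<^sup>* u x
      else \<forall>y\<in>V3. adjacent H x y \<longrightarrow> (adjacent base)\<^sup>*\<^sup>* u y"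
    if "(adjacent H)\<^sup>*\<^sup>* u x" "u \<in> V3" for u x
    using that(1)
  proof (induction rule: rtranclp_induct)
    case base
    then show ?case
      using that(2) by simp
  next
    case (step x y)
    obtain e where e: "e \<in> edges H" "ends H e = {#x, y#}"
      using step.hyps(2) by (auto simp: adjacent_def)
    show ?case
    proof (cases "x \<in> V3")
      case True
      then have y: "y \<in> V2"
        using bipartite[OF e(1)] e(2) disjoint by (auto simp: add_eq_conv_diff split: if_splits)
      have ux: "(adjacent base)\<^sup>*\<^sup>* u x"
        using step.IH True by simp
      have "(adjacent base)\<^sup>*\<^sup>* u z" if z: "z \<in> V3" "adjacent H y z" for z
      proof (cases "z = x")
        case False
        have mem: "a \<in># ends base y" if a: "a \<in> V3" "adjacent H y a" for a
        proof -
          obtain d where "d \<in> edges H" "ends H d = {#y, a#}"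
            using a(2) by (auto simp: adjacent_def)
          then have "d \<in> incident H a \<inter> incident H y"
            by (simp add: incident_def)
          then have "card (incident H a \<inter> incident H y) > 0"
            using finite_incident[OF fin] by (auto simp: card_gt_0_iff)
          then show ?thesis
            using count_ends_base[OF y a(1)] by (metis count_greater_zero_iff)
        qed
        have "x \<in># ends base y" "z \<in># ends base y"
          using mem True z adjacent_sym[OF step.hyps(2)] by blast+
        moreover obtain a b where "ends base y = {#a, b#}"
          using y by (rule ends_baseE)
        \<comment> \<open>Two distinct members exhaust a multiset of size two.\<close>
        ultimately have "ends base y = {#x, z#}"
          using False by (auto simp: add_mset_commute)
        then have "adjacent base x z"
          using y by (auto simp: adjacent_def)
        then show ?thesis
          using ux by simp
      qed (use ux in simp)
      then show ?thesis
        using y disjoint by auto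
    next
      case False
      then have "y \<in> V3"
        using bipartite[OF e(1)] e(2) by (auto simp: add_eq_conv_diff split: if_splits)
      then show ?thesis
        using False step.IH step.hyps(2) by simp
    qed
  qed
  have "V3 \<noteq> {}"
    using bipartite assms by blast
  moreover have "(adjacent base)\<^sup>*\<^sup>* u v" if "u \<in> V3" "v \<in> V3" for u v
    using reach[of u v] connected that by (simp add: connected_mgraph_def verts)
  ultimately show "connected_mgraph base"
    by (simp add: connected_mgraph_def)
qed

text \<open>A vertex of \<open>V3\<close> is an original vertex of the subdivision, and one of
  \<open>V2\<close> subdivides the edge it names. The half-edges between \<open>w\<close> and
  \<open>v\<close> are numbered from 0 up to the multiplicity of \<open>v\<close> in the edge
  \<open>w\<close>, so the parallel edges of H between them must be numbered in the same
  way.\<close>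

lemma iso_subdivision_base: "H \<simeq> subdivision base"
proof -
  define f where "f v = (if v \<in> V3 then Inl v else Inr v)" for v
  define par where "par w v = incident H v \<inter> incident H w" for w v
  have par: "e \<in> par w v \<longleftrightarrow> e \<in> edges H \<and> ends H e = {#w, v#}" if "w \<in> V2" "v \<in> V3" for w v e
  proof
    assume "e \<in> par w v"
    then show "e \<in> edges H \<and> ends H e = {#w, v#}"
      using that disjoint bipartite[of e] by (auto simp: par_def incident_def)
  qed (simp add: par_def incident_def)
  \<comment> \<open>A numbering of each parallel class is chosen for all pairs (w, v) at
    once.\<close>
  have "\<forall>p. \<exists>h. bij_betw h (par (fst p) (snd p)) {..<card (par (fst p) (snd p))}"
    using ex_bij_betw_finite_nat finite_incident[OF fin] by (metis par_def atLeast0LessThan finite_Int)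
  then obtain h where "\<forall>p. bij_betw (h p) (par (fst p) (snd p)) {..<card (par (fst p) (snd p))}"
    by metis
  then have h: "bij_betw (h (w, v)) (par w v) {..<card (par w v)}" for w v
    by (metis fst_conv snd_conv)
  obtain t2 t3 where t: "t2 e \<in> V2" "t3 e \<in> V3" "ends H e = {#t2 e, t3 e#}" if "e \<in> edges H" for e
    using bipartite by metis
  have t_par: "e \<in> par (t2 e) (t3 e)" if "e \<in> edges H" for e
    using t[OF that] par[of "t2 e" "t3 e" e] that by simp
  have t_eq: "t2 e = w" "t3 e = v" if "e \<in> par w v" "w \<in> V2" "v \<in> V3" for e w v
    using par[OF that(2,3), of e] that t[of e] disjoint by (auto simp: add_eq_conv_diff split: if_splits)
  define g where "g e = (t2 e, t3 e, h (t2 e, t3 e) e)" for e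
  show ?thesis
  proof (rule mgraph_isoI)
    show "bij_betw f (verts H) (verts (subdivision base))"
      using disjoint by (auto simp: f_def verts subdivision_def bij_betw_def inj_on_def)
    show "bij_betw g (edges H) (edges (subdivision base))"
    proof (rule bij_betw_imageI)
      show "inj_on g (edges H)"
      proof
        fix d e assume d: "d \<in> edges H" and e: "e \<in> edges H" and eq: "g d = g e"
        then have "d \<in> par (t2 e) (t3 e)" "h (t2 e, t3 e) d = h (t2 e, t3 e) e"
          using t_par[OF d] by (auto simp: g_def)
        then show "d = e"
          using h[of "t2 e" "t3 e"] t_par[OF e] by (auto simp: bij_betw_def dest: inj_onD)
      qed
      show "g ` edges H = edges (subdivision base)"
      proof (intro equalityI subsetI)
        fix x assume "x \<in> g ` edges H"
        then obtain e where e: "e \<in> edges H" "x = g e"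
          by blast
        then show "x \<in> edges (subdivision base)"
          using t[OF e(1)] t_par[OF e(1)] bij_betwE[OF h[of "t2 e" "t3 e"]] count_ends_base[of "t2 e" "t3 e"]
          by (simp add: g_def subdivision_def par_def del: base_simps(3))
      next
        fix x assume "x \<in> edges (subdivision base)"
        then obtain w v k where x: "x = (w, v, k)" "w \<in> V2" "k < count (ends base w) v"
          by (auto simp: subdivision_def simp del: base_simps(3))
        then have "v \<in># ends base w"
          by (simp del: base_simps(3) add: count_greater_zero_iff[symmetric] del: count_greater_zero_iff)
        moreover obtain a b where "ends base w = {#a, b#}" "a \<in> V3" "b \<in> V3"
          using x(2) by (rule ends_baseE)
        ultimately have v: "v \<in> V3"
          by (auto simp del: base_simps(3))
        then have "k \<in> h (w, v) ` par w v"
          using x h[of w v] count_ends_base[OF x(2) v] by (simp add: bij_betw_def par_def del: base_simps(3))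
        then obtain e where e: "e \<in> par w v" "k = h (w, v) e"
          by blast
        then have "g e = x" "e \<in> edges H"
          using t_eq[OF e(1) x(2) v] par[OF x(2) v] x(1) by (simp_all add: g_def)
        then show "x \<in> g ` edges H"
          by blast
      qed
    qed
    show "ends (subdivision base) (g e) = image_mset f (ends H e)" if "e \<in> edges H" for e
      using t[OF that] disjoint by (auto simp: g_def subdivision_def f_def add_mset_commute)
  qed
qed

end

subsection \<open>Cubic line graphs\<close>

text \<open>Degrees along an edge add up to five. Degree zero is impossible at an end of an edge,
  and degree four would make the line graph K_4, which leaves two and three as the degrees of the
  two ends.\<close>

lemma two_three_bipartite_if_cubic_line_graph:
  assumes H: "finite_mgraph H" "loopless H" "connected_mgraph H"
    and cubic: "cubic (line_graph H)" and ne: "edges H \<noteq> {}"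
    and K4: "\<not> line_graph H \<simeq> complete_graph 4"
  shows "two_three_bipartite H {v \<in> verts H. card (incident H v) = 2}
    {v \<in> verts H. card (incident H v) = 3}"
proof -
  have five: "card (incident H u) + card (incident H v) = 5"
    if "e \<in> edges H" "ends H e = {#u, v#}" for e u v
    using degree_line_graph[OF H(1,2) that] cubic that(1) by (simp add: cubic_def)
  have not4: "card (incident H v) \<noteq> 4" if "v \<in> verts H" for v
    using line_graph_star[OF H _ that] five K4 by blast
  have deg: "card (incident H u) \<in> {2, 3}" "card (incident H v) = 5 - card (incident H u)"
    if e: "e \<in> edges H" "ends H e = {#u, v#}" for e u v
  proof -
    have "card (incident H u) \<noteq> 0" "card (incident H v) \<noteq> 0"
      using e finite_incident[OF H(1)] by (auto simp: incident_def)
    moreover have "card (incident H u) \<noteq> 4" "card (incident H v) \<noteq> 4"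
      using e not4 finite_mgraphD(4)[OF H(1) e(1)] by auto
    ultimately show "card (incident H u) \<in> {2, 3}" "card (incident H v) = 5 - card (incident H u)"
      using five[OF e] by auto
  qed
  \<comment> \<open>No vertex is isolated: an edge has two distinct ends, one of which differs from
    \<open>x\<close>, and a walk from \<open>x\<close> to it starts with an edge at
    \<open>x\<close>.\<close>
  have "\<exists>e\<in>edges H. \<exists>y. ends H e = {#x, y#}" if x: "x \<in> verts H" for x
  proof -
    obtain e where e: "e \<in> edges H"
      using ne by blast
    obtain u v where uv: "ends H e = {#u, v#}" "u \<noteq> v" "u \<in> verts H" "v \<in> verts H"
      using H(1,2) e by (rule loopless_endsE)
    then obtain z where "z \<in> verts H" "z \<noteq> x"
      by metis
    then have "(adjacent H)\<^sup>*\<^sup>* x z"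
      using H(3) x by (simp add: connected_mgraph_def)
    then obtain y where "adjacent H x y"
      using \<open>z \<noteq> x\<close> by (metis converse_rtranclpE)
    then show ?thesis
      by (auto simp: adjacent_def)
  qed
  then have deg_vert: "card (incident H x) \<in> {2, 3}" if "x \<in> verts H" for x
    using deg(1) that by blast
  show ?thesis
  proof
    show "verts H = {v \<in> verts H. card (incident H v) = 2} \<union> {v \<in> verts H. card (incident H v) = 3}"
      using deg_vert by blast
    show "\<exists>w\<in>{v \<in> verts H. card (incident H v) = 2}. \<exists>v\<in>{v \<in> verts H. card (incident H v) = 3}.
        ends H e = {#w, v#}" if e: "e \<in> edges H" for e
    proof -
      obtain u v where uv: "ends H e = {#u, v#}" "u \<in> verts H" "v \<in> verts H"
        using H(1,2) e by (rule loopless_endsE)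
      then have vu: "ends H e = {#v, u#}"
        by (simp add: add_mset_commute)
      show ?thesis
      proof (cases "card (incident H u) = 2")
        case True
        then show ?thesis
          using uv deg(2)[OF e uv(1)] by auto
      next
        case False
        then have "card (incident H u) = 3" "card (incident H v) = 2"
          using deg[OF e uv(1)] by auto
        then show ?thesis
          using uv vu by auto
      qed
    qed
  qed (use H in auto)
qed

text \<open>Vertices and edges of \<open>base\<close> both have the vertex type of H. Renaming the
  vertices of H by natural numbers therefore makes G^+ a graph of type
  \<open>(nat, nat) mgraph\<close>.\<close>

lemma line_graph_of_nat_mgraph:
  fixes H :: "('c, 'd) mgraph"
  assumes "is_line_graph_of G H"
  obtains H' :: "(nat, 'd) mgraph" where "is_line_graph_of G H'"
proof -
  have H: "finite_mgraph H" "loopless H" "connected_mgraph H" "G \<simeq> line_graph H"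
    using assms by (simp_all add: is_line_graph_of_def)
  obtain h :: "'c \<Rightarrow> nat" where h: "inj_on h (verts H)"
    using finite_imp_inj_to_nat_seg[OF finite_mgraphD(1)[OF H(1)]] by blast
  define H' where "H' = \<lparr>verts = h ` verts H, edges = edges H, ends = \<lambda>e. image_mset h (ends H e)\<rparr>"
  have iso: "H \<simeq> H'"
    by (rule mgraph_isoI[of h _ _ id]) (auto simp: H'_def h bij_betw_def)
  have "is_line_graph_of G H'"
    unfolding is_line_graph_of_def
    using finite_mgraph_iso[OF H(1) iso] loopless_iso[OF H(1) iso H(2)]
      connected_mgraph_iso[OF iso H(3)] mgraph_iso_trans[OF H(4) line_graph_iso[OF H(1) iso]]
    by blast
  then show thesis
    by (rule that)
qed

lemma cubic_line_graph_structure: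
  fixes G :: "('a, 'b) mgraph" and H :: "('c, 'd) mgraph"
  assumes G: "connected_cubic G" and GH: "is_line_graph_of G H" and K4: "\<not> G \<simeq> complete_graph 4"
  shows "\<exists>G' :: (nat, nat) mgraph. connected_cubic G' \<and>
      real (card (verts G')) = real (card (verts G)) / 3 \<and> G \<simeq> line_graph (subdivision G')"
    and "real (num_perfect_matchings G) = 2 powr (real (card (verts G)) / 6 + 1)"
proof -
  obtain K :: "(nat, 'd) mgraph" where "is_line_graph_of G K"
    using GH by (rule line_graph_of_nat_mgraph)
  then have K: "finite_mgraph K" "loopless K" "connected_mgraph K" "G \<simeq> line_graph K"
    by (simp_all add: is_line_graph_of_def)
  have finG: "finite_mgraph G"
    using G by (simp add: connected_cubic_def)
  \<comment> \<open>The order of G is the number of edges of the root graph, which turns the edge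
    counts of the locale into statements about G.\<close>
  have card: "card (verts G) = card (edges K)"
    using K(4) by (auto simp: mgraph_iso_def dest: bij_betw_same_card)
  have "edges K \<noteq> {}"
    using card G finite_mgraphD(1)[OF finG] by (auto simp: connected_cubic_def connected_mgraph_def)
  have "cubic (line_graph K)"
    using cubic_iso[OF finG K(4)] G by (simp add: connected_cubic_def)
  moreover have "\<not> line_graph K \<simeq> complete_graph 4"
    using K4 mgraph_iso_trans[OF K(4)] by blast
  ultimately interpret two_three_bipartite K "{v \<in> verts K. card (incident K v) = 2}"
      "{v \<in> verts K. card (incident K v) = 3}"
    using K \<open>edges K \<noteq> {}\<close> by (intro two_three_bipartite_if_cubic_line_graph)
  show "\<exists>G' :: (nat, nat) mgraph. connected_cubic G' \<and>
      real (card (verts G')) = real (card (verts G)) / 3 \<and> G \<simeq> line_graph (subdivision G')"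
  proof (intro exI conjI)
    show "connected_cubic base"
      using \<open>edges K \<noteq> {}\<close> by (rule connected_cubic_base)
    show "real (card (verts base)) = real (card (verts G)) / 3"
      using card_edges(2) card by simp
    show "G \<simeq> line_graph (subdivision base)"
      using mgraph_iso_trans[OF K(4) line_graph_iso[OF K(1) iso_subdivision_base]] .
  qed
  show "real (num_perfect_matchings G) = 2 powr (real (card (verts G)) / 6 + 1)"
    using num_perfect_matchings[OF \<open>edges K \<noteq> {}\<close>] num_perfect_matchings_iso[OF finG K(4)] card
    by simp
qed

section \<open>The entropy limit\<close>

lemma entropy_limit:
  fixes N :: "nat \<Rightarrow> nat"
  assumes "filterlim N at_top sequentially"
  shows "(\<lambda>n. 2 * ln (2 powr (real (N n) / 6 + 1)) / real (N n)) \<longlonglongrightarrow> ln 2 / 3"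
proof -
  have "filterlim (\<lambda>n. real (N n)) at_top sequentially"
    using filterlim_compose[OF filterlim_real_sequentially assms] .
  then have "(\<lambda>n. ln 2 / 3 + 2 * ln 2 / real (N n)) \<longlonglongrightarrow> ln 2 / 3 + 0"
    by (intro tendsto_add tendsto_const tendsto_divide_0[OF tendsto_const]
        filterlim_at_top_imp_at_infinity)
  \<comment> \<open>The quotient equals ln 2 / 3 + 2 ln 2 / N only for nonzero N, which holds
    eventually.\<close>
  moreover have "\<forall>\<^sub>F n in sequentially. N n \<ge> 1"
    using assms by (simp add: filterlim_at_top)
  then have "\<forall>\<^sub>F n in sequentially. ln 2 / 3 + 2 * ln 2 / real (N n)
      = 2 * ln (2 powr (real (N n) / 6 + 1)) / real (N n)"
    by eventually_elim (simp add: ln_powr field_simps)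
  ultimately show ?thesis
    by (auto intro: Lim_transform_eventually)
qed

theorem theorem2p7:
  shows
    "(\<forall>(G :: ('a, 'b) mgraph) (H :: ('c, 'd) mgraph).
        connected_cubic G \<and> is_line_graph_of G H \<longrightarrow>
          (G \<simeq> complete_graph 4 \<longrightarrow> num_perfect_matchings G = 3) \<and>
          (\<not> G \<simeq> complete_graph 4 \<longrightarrow>
            (\<exists>G' :: (nat, nat) mgraph. connected_cubic G' \<and>
               real (card (verts G')) = real (card (verts G)) / 3 \<and>
               G \<simeq> line_graph (subdivision G')) \<and>
            real (num_perfect_matchings G) = 2 powr (real (card (verts G)) / 6 + 1))) \<and>
     (\<forall>(Gs :: nat \<Rightarrow> ('a, 'b) mgraph) (Hs :: nat \<Rightarrow> ('c, 'd) mgraph).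
        (\<forall>n. connected_cubic (Gs n) \<and> is_line_graph_of (Gs n) (Hs n) \<and>
             \<not> Gs n \<simeq> complete_graph 4) \<and>
        filterlim (\<lambda>n. card (verts (Gs n))) at_top sequentially \<longrightarrow>
          (\<lambda>n. 2 * ln (real (num_perfect_matchings (Gs n))) / real (card (verts (Gs n))))
            \<longlonglongrightarrow> ln 2 / 3)"
proof (intro conjI allI impI)
  fix G :: "('a, 'b) mgraph" and H :: "('c, 'd) mgraph"
  assume G: "connected_cubic G \<and> is_line_graph_of G H"
  show "num_perfect_matchings G = 3" if "G \<simeq> complete_graph 4"
    using num_perfect_matchings_iso[OF _ that] G complete_graph_4_matchings
    by (simp add: connected_cubic_def)
  assume "\<not> G \<simeq> complete_graph 4"
  then show "\<exists>G' :: (nat, nat) mgraph. connected_cubic G' \<and>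
      real (card (verts G')) = real (card (verts G)) / 3 \<and> G \<simeq> line_graph (subdivision G')"
    "real (num_perfect_matchings G) = 2 powr (real (card (verts G)) / 6 + 1)"
    using cubic_line_graph_structure[of G H] G by blast+
next
  fix Gs :: "nat \<Rightarrow> ('a, 'b) mgraph" and Hs :: "nat \<Rightarrow> ('c, 'd) mgraph"
  assume Gs: "(\<forall>n. connected_cubic (Gs n) \<and> is_line_graph_of (Gs n) (Hs n) \<and>
      \<not> Gs n \<simeq> complete_graph 4) \<and> filterlim (\<lambda>n. card (verts (Gs n))) at_top sequentially"
  then have "real (num_perfect_matchings (Gs n)) = 2 powr (real (card (verts (Gs n))) / 6 + 1)" for n
    using cubic_line_graph_structure(2) by blast
  then show "(\<lambda>n. 2 * ln (real (num_perfect_matchings (Gs n))) / real (card (verts (Gs n))))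
      \<longlonglongrightarrow> ln 2 / 3"
    using entropy_limit Gs by simp
qed

end
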